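(* Fix a $\rho$-flag on $V$ with adapted basis $v_1,\dots,v_n$; a $G$-graded structure on it is given by an arbitrary tuple $(h_1,\dots,h_n)\in G^n$ with $\deg v_i=h_i$. Let $\mathcal F$ and $\mathcal F'$ be the $G$-graded $\rho$-flags given by $(h_i)$ and $(h'_i)$. Then ${\rm END}(\mathcal F)\cong{\rm END}(\mathcal F')$ as $G$-graded algebras if and only if $(h_i)$ and $(h'_i)$ lie in the same orbit of the right action of the group $\prod_{\alpha\in\mathcal C}S(\alpha)\rtimes({\rm Aut}_0(\mathcal C)\ltimes G^q)$ on $G^n$ described in the context; equivalently, iff there exist $(\psi_\alpha)_{\alpha\in\mathcal C}\in\prod_{\alpha}S(\alpha)$, $g\in{\rm Aut}_0(\mathcal C)$ and $(\sigma_t)_{1\le t\le q}\in G^q$ such that $h'_i=h_{\psi_{g(\hat i)}(\tilde g(i))}\,\sigma_{p(i)}$ for all $1\le i\le n$, where $p(i)$ is the index with $\hat i\in\mathcal C^{p(i)}$. Thus the isomorphism classes of $G$-graded algebras ${\rm END}(\mathcal F)$, $\mathcal F$ a $G$-graded $\rho$-flag, correspond bijectively to the orbits of this action.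
   Context: Let $k$ be a field, $G$ a group, $\rho$ a preorder on $\{1,\dots,n\}$; $i\sim j$ iff $i\rho j$ and $j\rho i$; $\mathcal C$ is the set of classes, $\hat i$ the class of $i$, ordered by $\hat i\le\hat j$ iff $i\rho j$; $m_\alpha=|\alpha|$. A $\rho$-flag $(V,(V_\alpha)_{\alpha\in\mathcal C})$ is an $n$-dimensional $k$-space with subspaces $V_\alpha$ having a basis $v_1,\dots,v_n$ with $\{v_i:\hat i\le\alpha\}$ a basis of $V_\alpha$ for all $\alpha$ (adapted basis). A $G$-graded $\rho$-flag is a $\rho$-flag where $V$ is $G$-graded and the adapted basis is homogeneous. ${\rm END}(\mathcal F)$ is the algebra of linear $f:V\to V$ with $f(V_\alpha)\subseteq V_\alpha$, graded by ${\rm END}(\mathcal F)_\sigma=\{f: f(V_h)\subseteq V_{\sigma h}\ \forall h\in G\}$. ${\rm Aut}_0(\mathcal C)$ is the group of poset automorphisms $g$ of $\mathcal C$ with $m_{g(\alpha)}=m_\alpha$; for such $g$, $\tilde g\in S_n$ is given by: if $\alpha=\{i_1<\dots<i_r\}$ and $g(\alpha)=\{j_1<\dots<j_r\}$ then $\tilde g(i_s)=j_s$. $\mathcal C^1,\dots,\mathcal C^q$ are the connected components of $\mathcal C$ (of its comparability graph), and $\tau_g\in S_q$ is defined by $g(\mathcal C^t)=\mathcal C^{\tau_g(t)}$. $S(\alpha)$ is the symmetric group on the subset $\alpha\subseteq\{1,\dots,n\}$. Right actions on $G^n$: $(h_i)\leftarrow g=(h_{\tilde g(i)})_i$; $(h_i)\leftarrow(\sigma_t)=(h_i\sigma_{p(i)})_i$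 with $\hat i\in\mathcal C^{p(i)}$; $(h_i)\leftarrow(\psi_\alpha)=(h_{\psi_{\hat i}(i)})_i$. ${\rm Aut}_0(\mathcal C)$ acts on the right on $G^q$ by $(\sigma_t)\leftarrow g=(\sigma_{\tau_g(t)})_t$, giving ${\rm Aut}_0(\mathcal C)\ltimes G^q$; ${\rm Aut}_0(\mathcal C)$ acts on the left on $\prod_\alpha S(\alpha)$ by $g\to(\psi_\alpha)=(\psi'_\alpha)$ with $\psi'_\alpha(i)=\tilde g(\psi_{g^{-1}(\alpha)}(\tilde g^{-1}(i)))$ (and $G^q$ acts trivially), giving $\prod_\alpha S(\alpha)\rtimes({\rm Aut}_0(\mathcal C)\ltimes G^q)$. Its right action on $G^n$ is $(h_i)\leftarrow((\psi_\alpha)\rtimes(g\ltimes(\sigma_t)))=(((h_i)\leftarrow(\psi_\alpha))\leftarrow g)\leftarrow(\sigma_t)$. *)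

theory Defs
  imports Complex_Main "HOL-Combinatorics.Permutations"
begin

text \<open>Indices run over 0..<n (instead of 1..n). The group G is a type of class group_add,
  written additively (not necessarily commutative); the paper's product x y is x + y.\<close>

text \<open>Class of i under the equivalence induced by the preorder rho.\<close>
definition cls :: "(nat \<Rightarrow> nat \<Rightarrow> bool) \<Rightarrow> nat \<Rightarrow> nat \<Rightarrow> nat set" where
  "cls \<rho> n i = {j. j < n \<and> \<rho> i j \<and> \<rho> j i}"

definition classes :: "(nat \<Rightarrow> nat \<Rightarrow> bool) \<Rightarrow> nat \<Rightarrow> nat set set" where
  "classes \<rho> n = cls \<rho> n ` {0..<n}"

text \<open>Order on classes: hat i <= hat j iff i rho j.\<close>
definition cle :: "(nat \<Rightarrow> nat \<Rightarrow> bool) \<Rightarrow> nat set \<Rightarrow> nat set \<Rightarrow> bool" where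
  "cle \<rho> \<alpha> \<beta> = (\<exists>i\<in>\<alpha>. \<exists>j\<in>\<beta>. \<rho> i j)"

text \<open>Aut_0(C): poset automorphisms of C preserving the sizes of classes.\<close>
definition Aut0 :: "(nat \<Rightarrow> nat \<Rightarrow> bool) \<Rightarrow> nat \<Rightarrow> (nat set \<Rightarrow> nat set) set" where
  "Aut0 \<rho> n = {g. bij_betw g (classes \<rho> n) (classes \<rho> n)
      \<and> (\<forall>\<alpha>\<in>classes \<rho> n. \<forall>\<beta>\<in>classes \<rho> n. cle \<rho> \<alpha> \<beta> \<longleftrightarrow> cle \<rho> (g \<alpha>) (g \<beta>))
      \<and> (\<forall>\<alpha>\<in>classes \<rho> n. card (g \<alpha>) = card \<alpha>)}"

text \<open>g tilde: the s-th smallest element of hat i goes to the s-th smallest element of g(hat i).\<close>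
definition gtilde :: "(nat \<Rightarrow> nat \<Rightarrow> bool) \<Rightarrow> nat \<Rightarrow> (nat set \<Rightarrow> nat set) \<Rightarrow> nat \<Rightarrow> nat" where
  "gtilde \<rho> n g i = sorted_list_of_set (g (cls \<rho> n i)) ! card {j \<in> cls \<rho> n i. j < i}"

text \<open>Comparability graph on C and its connected components.\<close>
definition comparable :: "(nat \<Rightarrow> nat \<Rightarrow> bool) \<Rightarrow> nat \<Rightarrow> nat set \<Rightarrow> nat set \<Rightarrow> bool" where
  "comparable \<rho> n \<alpha> \<beta> = (\<alpha> \<in> classes \<rho> n \<and> \<beta> \<in> classes \<rho> n \<and> (cle \<rho> \<alpha> \<beta> \<or> cle \<rho> \<beta> \<alpha>))"

definition component :: "(nat \<Rightarrow> nat \<Rightarrow> bool) \<Rightarrow> nat \<Rightarrow> nat set \<Rightarrow> nat set set" where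
  "component \<rho> n \<alpha> = {\<beta>. (comparable \<rho> n)\<^sup>*\<^sup>* \<alpha> \<beta>}"

text \<open>The flag subspaces V_alpha, spanned by the adapted basis vectors v_i with hat i <= alpha.\<close>
definition Vflag :: "(nat \<Rightarrow> nat \<Rightarrow> bool) \<Rightarrow> nat \<Rightarrow> ('k::field \<Rightarrow> 'v::ab_group_add \<Rightarrow> 'v)
    \<Rightarrow> (nat \<Rightarrow> 'v) \<Rightarrow> nat set \<Rightarrow> 'v set" where
  "Vflag \<rho> n scale v \<alpha> = Modules.module.span scale (v ` {i. i < n \<and> cle \<rho> (cls \<rho> n i) \<alpha>})"

text \<open>END(F): linear endomorphisms of V preserving every V_alpha.\<close>
definition ENDF :: "(nat \<Rightarrow> nat \<Rightarrow> bool) \<Rightarrow> nat \<Rightarrow> ('k::field \<Rightarrow> 'v::ab_group_add \<Rightarrow> 'v)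
    \<Rightarrow> (nat \<Rightarrow> 'v) \<Rightarrow> ('v \<Rightarrow> 'v) set" where
  "ENDF \<rho> n scale v = {f. Vector_Spaces.linear scale scale f
      \<and> (\<forall>\<alpha>\<in>classes \<rho> n. f ` Vflag \<rho> n scale v \<alpha> \<subseteq> Vflag \<rho> n scale v \<alpha>)}"

text \<open>Homogeneous component V_x of V for the grading deg v_i = h i.\<close>
definition Vdeg :: "nat \<Rightarrow> ('k::field \<Rightarrow> 'v::ab_group_add \<Rightarrow> 'v) \<Rightarrow> (nat \<Rightarrow> 'v)
    \<Rightarrow> (nat \<Rightarrow> 'g) \<Rightarrow> 'g \<Rightarrow> 'v set" where
  "Vdeg n scale v h x = Modules.module.span scale (v ` {i. i < n \<and> h i = x})"

text \<open>END(F)_sigma = {f. f(V_x) \<subseteq> V_(sigma x) for all x}.\<close>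
definition ENDdeg :: "(nat \<Rightarrow> nat \<Rightarrow> bool) \<Rightarrow> nat \<Rightarrow> ('k::field \<Rightarrow> 'v::ab_group_add \<Rightarrow> 'v)
    \<Rightarrow> (nat \<Rightarrow> 'v) \<Rightarrow> (nat \<Rightarrow> 'g::group_add) \<Rightarrow> 'g \<Rightarrow> ('v \<Rightarrow> 'v) set" where
  "ENDdeg \<rho> n scale v h \<sigma> = {f \<in> ENDF \<rho> n scale v.
      \<forall>x. f ` Vdeg n scale v h x \<subseteq> Vdeg n scale v h (\<sigma> + x)}"

text \<open>END(F) and END(F') are isomorphic as G-graded (unital, associative) k-algebras.\<close>
definition graded_END_iso :: "(nat \<Rightarrow> nat \<Rightarrow> bool) \<Rightarrow> nat \<Rightarrow> ('k::field \<Rightarrow> 'v::ab_group_add \<Rightarrow> 'v)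
    \<Rightarrow> (nat \<Rightarrow> 'v) \<Rightarrow> (nat \<Rightarrow> 'g::group_add) \<Rightarrow> (nat \<Rightarrow> 'g) \<Rightarrow> bool" where
  "graded_END_iso \<rho> n scale v h h' =
    (\<exists>\<Phi>. bij_betw \<Phi> (ENDF \<rho> n scale v) (ENDF \<rho> n scale v)
      \<and> (\<forall>f\<in>ENDF \<rho> n scale v. \<forall>f'\<in>ENDF \<rho> n scale v.
            \<Phi> (\<lambda>x. f x + f' x) = (\<lambda>x. \<Phi> f x + \<Phi> f' x) \<and> \<Phi> (f \<circ> f') = \<Phi> f \<circ> \<Phi> f')
      \<and> (\<forall>c. \<forall>f\<in>ENDF \<rho> n scale v. \<Phi> (\<lambda>x. scale c (f x)) = (\<lambda>x. scale c (\<Phi> f x)))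
      \<and> \<Phi> id = id
      \<and> (\<forall>\<sigma>. \<Phi> ` ENDdeg \<rho> n scale v h \<sigma> = ENDdeg \<rho> n scale v h' \<sigma>))"

end

theory Submission
  imports Defs
begin

text \<open>
  \<open>END(F)\<close> is the incidence algebra of \<open>\<rho>\<close>: an endomorphism belongs to it iff its matrix
  entries vanish off \<open>\<rho>\<close>, and the matrix unit \<open>E\<^sub>a\<^sub>b\<close> is homogeneous of degree
  \<open>h a - h b\<close>. A graded isomorphism \<open>\<Phi>\<close> sends the \<open>E\<^sub>i\<^sub>i\<close> to orthogonal rank-one idempotents of degree
  \<open>0\<close>; choosing for each \<open>i\<close> an index \<open>a\<close> at which \<open>\<Phi> E\<^sub>i\<^sub>i\<close> has a nonzero diagonal entry, the
  nonvanishing of the corresponding entries of \<open>\<Phi> E\<^sub>i\<^sub>j\<close> shows that this choice respects \<open>\<rho>\<close> and the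
  degrees of matrix units. A dimension count inside each block of indices of equal class and
  \<open>h'\<close>-degree turns it into a bijection; being monotone on a finite preorder, its inverse \<open>k\<close> is an automorphism with
  \<open>h (k a) - h (k b) = h' a - h' b\<close> for \<open>\<rho> a b\<close>. Conversely, conjugating by the basis permutation \<open>k\<close>
  is a graded isomorphism. Finally such \<open>k\<close> are exactly the orbit data: \<open>k\<close> permutes the classes,
  giving \<open>g \<in> Aut\<^sub>0(C)\<close>; it differs from \<open>g\<close>-tilde by permutations \<open>\<psi>\<^sub>\<alpha>\<close> inside the classes;
  and \<open>- h (k i) + h' i\<close> is constant on connected components, giving \<open>\<sigma>\<close>.
\<close>

section \<open>Finite bijections and ranks\<close>

lemma endo_inj_bij_betw: "finite A \<Longrightarrow> f ` A \<subseteq> A \<Longrightarrow> inj_on f A \<Longrightarrow> bij_betw f A A"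
  by (simp add: bij_betw_def endo_inj_surj)

lemma bij_betw_reflects_rel:
  assumes A: "finite A" and \<pi>: "bij_betw \<pi> A A"
    and pres: "\<And>x y. x \<in> A \<Longrightarrow> y \<in> A \<Longrightarrow> R x y \<Longrightarrow> R (\<pi> x) (\<pi> y)"
    and xy: "x \<in> A" "y \<in> A" "R (\<pi> x) (\<pi> y)"
  shows "R x y"
proof -
  \<comment> \<open>On the finite graph of \<open>R\<close> the injective map \<open>\<pi> \<times> \<pi>\<close> is onto.\<close>
  define G where "G = {p \<in> A \<times> A. R (fst p) (snd p)}"
  define m where "m p = (\<pi> (fst p), \<pi> (snd p))" for p
  have inj: "inj_on \<pi> A" and into: "\<pi> ` A = A" using \<pi> by (auto simp: bij_betw_def)
  have "m ` G = G"
  proof (rule endo_inj_surj)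
    show "finite G" using A by (simp add: G_def)
    show "m ` G \<subseteq> G" using pres into by (auto simp: G_def m_def)
    show "inj_on m G" using inj by (auto simp: G_def m_def inj_on_def)
  qed
  moreover have "(\<pi> x, \<pi> y) \<in> G" using xy into by (auto simp: G_def)
  ultimately obtain p where p: "p \<in> G" "m p = (\<pi> x, \<pi> y)" by (metis imageE)
  then have "fst p = x" "snd p = y" using inj xy by (auto simp: G_def m_def inj_on_def)
  then show ?thesis using p by (auto simp: G_def)
qed

lemma ex_bij_betw_fibres_eq:
  assumes A: "finite A" and fibres: "\<And>K. card {x \<in> A. f x = K} = card {x \<in> A. g x = K}"
  shows "\<exists>\<pi>. bij_betw \<pi> A A \<and> (\<forall>x\<in>A. f (\<pi> x) = g x)"
proof -
  have "\<exists>F. bij_betw F {x \<in> A. g x = K} {x \<in> A. f x = K}" for K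
    by (rule finite_same_card_bij) (use A fibres in auto)
  then obtain F where F: "\<And>K. bij_betw (F K) {x \<in> A. g x = K} {x \<in> A. f x = K}" by metis
  define \<pi> where "\<pi> x = F (g x) x" for x
  have \<pi>: "\<pi> x \<in> A \<and> f (\<pi> x) = g x" if "x \<in> A" for x
    using bij_betwE[OF F[of "g x"]] that by (auto simp: \<pi>_def)
  have "inj_on \<pi> A"
  proof (rule inj_onI)
    fix x y assume x: "x \<in> A" and y: "y \<in> A" and eq: "\<pi> x = \<pi> y"
    then have "g x = g y" using \<pi> by metis
    then show "x = y"
      using eq x y bij_betw_imp_inj_on[OF F[of "g x"]] by (auto simp: \<pi>_def inj_on_def)
  qed
  then have "bij_betw \<pi> A A" using A \<pi> by (intro endo_inj_bij_betw) auto
  then show ?thesis using \<pi> by blast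
qed

lemma card_less_in_less_card:
  assumes "finite S" "(i::nat) \<in> S" shows "card {j \<in> S. j < i} < card S"
  using assms by (intro psubset_card_mono) auto

lemma card_less_in_strict_mono:
  assumes "finite S" "i \<in> S" "(i::nat) < i'"
  shows "card {j \<in> S. j < i} < card {j \<in> S. j < i'}"
  using assms by (intro psubset_card_mono) auto

lemma card_less_in_inj:
  assumes "finite S" "i \<in> S" "i' \<in> S" "card {j \<in> S. j < i} = card {j \<in> S. j < (i'::nat)}"
  shows "i = i'"
  using card_less_in_strict_mono[of S i i'] card_less_in_strict_mono[of S i' i] assms
  by (cases i i' rule: linorder_cases) auto

lemma nth_sorted_list_of_set_in: "finite T \<Longrightarrow> p < card T \<Longrightarrow> sorted_list_of_set T ! p \<in> T"
  by (metis nth_mem length_sorted_list_of_set set_sorted_list_of_set)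

lemma nth_sorted_list_of_set_inj: "finite T \<Longrightarrow> p < card T \<Longrightarrow> q < card T \<Longrightarrow>
   sorted_list_of_set T ! p = sorted_list_of_set T ! q \<Longrightarrow> p = q"
  by (metis distinct_sorted_list_of_set length_sorted_list_of_set nth_eq_iff_index_eq)

section \<open>Classes of the preorder and the orbit condition\<close>

lemma classes_iff: "\<alpha> \<in> classes \<rho> n \<longleftrightarrow> (\<exists>i<n. \<alpha> = cls \<rho> n i)"
  by (auto simp: classes_def)

lemma cls_subset: "cls \<rho> n i \<subseteq> {0..<n}"
  by (auto simp: cls_def)

lemma finite_cls: "finite (cls \<rho> n i)"
  using cls_subset by (rule finite_subset) simp

lemma less_of_mem_cls: "x \<in> cls \<rho> n i \<Longrightarrow> x < n"
  by (auto simp: cls_def)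

definition preorder_auto :: "(nat \<Rightarrow> nat \<Rightarrow> bool) \<Rightarrow> nat \<Rightarrow> (nat \<Rightarrow> nat) \<Rightarrow> bool" where
  "preorder_auto \<rho> n k \<longleftrightarrow> bij_betw k {0..<n} {0..<n} \<and> (\<forall>a<n. \<forall>b<n. \<rho> (k a) (k b) \<longleftrightarrow> \<rho> a b)"

definition elementary_degrees_agree ::
    "(nat \<Rightarrow> nat \<Rightarrow> bool) \<Rightarrow> nat \<Rightarrow> (nat \<Rightarrow> 'g::group_add) \<Rightarrow> (nat \<Rightarrow> 'g) \<Rightarrow> bool" where
  "elementary_degrees_agree \<rho> n h h' \<longleftrightarrow> (\<forall>a<n. \<forall>b<n. \<rho> a b \<longrightarrow> h a - h b = h' a - h' b)"

lemma diff_eq_diff_iff_minus_add_eq: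
  fixes x :: "'g::group_add" shows "x - y = x' - y' \<longleftrightarrow> - x + x' = - y + y'"
proof -
  have shift: "x + z = x' \<longleftrightarrow> - x + x' = z" for z by auto
  have "x - y = x' - y' \<longleftrightarrow> x - y + y' = x'" by (rule eq_diff_eq)
  also have "x - y + y' = x + (- y + y')" by (simp only: diff_conv_add_uminus add.assoc)
  finally show ?thesis by (simp only: shift)
qed

locale index_preorder =
  fixes \<rho> :: "nat \<Rightarrow> nat \<Rightarrow> bool" and n :: nat
  assumes refl: "\<forall>i<n. \<rho> i i"
    and trans: "\<forall>i<n. \<forall>j<n. \<forall>k<n. \<rho> i j \<and> \<rho> j k \<longrightarrow> \<rho> i k"
begin

lemma rel_trans: "a < n \<Longrightarrow> b < n \<Longrightarrow> c < n \<Longrightarrow> \<rho> a b \<Longrightarrow> \<rho> b c \<Longrightarrow> \<rho> a c"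
  using trans by blast

lemma mem_cls_self: "i < n \<Longrightarrow> i \<in> cls \<rho> n i"
  using refl by (simp add: cls_def)

lemma cls_in_classes: "i < n \<Longrightarrow> cls \<rho> n i \<in> classes \<rho> n"
  by (auto simp: classes_iff)

lemma cle_cls_iff:
  assumes "i < n" "j < n" shows "cle \<rho> (cls \<rho> n i) (cls \<rho> n j) \<longleftrightarrow> \<rho> i j"
proof
  assume "cle \<rho> (cls \<rho> n i) (cls \<rho> n j)"
  then obtain x y where "x < n" "\<rho> i x" "y < n" "\<rho> y j" "\<rho> x y"
    unfolding cle_def cls_def by auto
  then show "\<rho> i j" using rel_trans assms by metis
next
  assume "\<rho> i j"
  then show "cle \<rho> (cls \<rho> n i) (cls \<rho> n j)"
    unfolding cle_def using mem_cls_self assms by blast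
qed

lemma cls_eq_iff:
  assumes i: "i < n" and j: "j < n" shows "cls \<rho> n i = cls \<rho> n j \<longleftrightarrow> \<rho> i j \<and> \<rho> j i"
proof
  assume "cls \<rho> n i = cls \<rho> n j"
  then have "j \<in> cls \<rho> n i" using mem_cls_self[OF j] by simp
  then show "\<rho> i j \<and> \<rho> j i" by (simp add: cls_def)
next
  assume "\<rho> i j \<and> \<rho> j i"
  then show "cls \<rho> n i = cls \<rho> n j"
    unfolding cls_def using i j rel_trans by (intro Collect_cong) meson
qed

lemma cls_eq_of_mem: "m < n \<Longrightarrow> x \<in> cls \<rho> n m \<Longrightarrow> cls \<rho> n x = cls \<rho> n m"
  by (subst cls_eq_iff) (auto simp: cls_def)

lemma component_eq_if_rel:
  assumes a: "a < n" and b: "b < n" and "\<rho> a b"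
  shows "component \<rho> n (cls \<rho> n a) = component \<rho> n (cls \<rho> n b)"
proof -
  have ab: "comparable \<rho> n (cls \<rho> n a) (cls \<rho> n b)" and ba: "comparable \<rho> n (cls \<rho> n b) (cls \<rho> n a)"
    using assms cle_cls_iff[OF a b] by (auto simp: comparable_def cls_in_classes)
  show ?thesis
    unfolding component_def
    using converse_rtranclp_into_rtranclp[where r="comparable \<rho> n", OF ab]
      converse_rtranclp_into_rtranclp[where r="comparable \<rho> n", OF ba]
    by blast
qed

lemma eq_on_component:
  assumes f: "\<And>a b. a < n \<Longrightarrow> b < n \<Longrightarrow> \<rho> a b \<Longrightarrow> f a = f b"
    and path: "(comparable \<rho> n)\<^sup>*\<^sup>* (cls \<rho> n i) (cls \<rho> n j)" and i: "i < n" and j: "j < n"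
  shows "f j = f i"
proof -
  have "\<forall>j<n. \<beta> = cls \<rho> n j \<longrightarrow> f j = f i" if "(comparable \<rho> n)\<^sup>*\<^sup>* (cls \<rho> n i) \<beta>" for \<beta>
    using that
  proof (induction rule: rtranclp_induct)
    case base
    show ?case
    proof (intro allI impI)
      fix j assume "j < n" "cls \<rho> n i = cls \<rho> n j"
      then show "f j = f i" using f[OF i] cls_eq_iff[OF i] by auto
    qed
  next
    case (step \<gamma> \<beta>)
    obtain m where m: "m < n" "\<gamma> = cls \<rho> n m" using step.hyps(2) by (auto simp: comparable_def classes_iff)
    show ?case
    proof (intro allI impI)
      fix j assume j: "j < n" "\<beta> = cls \<rho> n j"
      have "\<rho> m j \<or> \<rho> j m"
        using step.hyps(2) cle_cls_iff[OF m(1) j(1)] cle_cls_iff[OF j(1) m(1)] m j by (auto simp: comparable_def)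
      then show "f j = f i" using f[OF m(1) j(1)] f[OF j(1) m(1)] step.IH m by auto
    qed
  qed
  then show ?thesis using path j by blast
qed

lemma ex_function_of_component:
  assumes f: "\<And>a b. a < n \<Longrightarrow> b < n \<Longrightarrow> \<rho> a b \<Longrightarrow> f a = f b"
  shows "\<exists>\<sigma>. \<forall>i<n. f i = \<sigma> (component \<rho> n (cls \<rho> n i))"
proof -
  define rep where "rep C = (SOME j. j < n \<and> C = component \<rho> n (cls \<rho> n j))" for C
  have "f i = f (rep (component \<rho> n (cls \<rho> n i)))" if i: "i < n" for i
  proof -
    obtain j where rep: "rep (component \<rho> n (cls \<rho> n i)) = j" by simp
    have "\<exists>j. j < n \<and> component \<rho> n (cls \<rho> n i) = component \<rho> n (cls \<rho> n j)"
      using i by blast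
    then have "j < n \<and> component \<rho> n (cls \<rho> n i) = component \<rho> n (cls \<rho> n j)"
      unfolding rep[symmetric] rep_def by (rule someI_ex)
    then have j: "j < n" "component \<rho> n (cls \<rho> n i) = component \<rho> n (cls \<rho> n j)" by auto
    have "cls \<rho> n j \<in> component \<rho> n (cls \<rho> n i)"
      unfolding j(2) by (simp add: component_def)
    then have "(comparable \<rho> n)\<^sup>*\<^sup>* (cls \<rho> n i) (cls \<rho> n j)"
      by (simp add: component_def)
    then have "f j = f i" using eq_on_component[where f=f, OF f _ i j(1)] by simp
    then show ?thesis using rep by simp
  qed
  then show ?thesis by (intro exI[of _ "\<lambda>C. f (rep C)"]) simp
qed

context
  fixes g assumes g: "g \<in> Aut0 \<rho> n"
begin

lemma Aut0_bij: "bij_betw g (classes \<rho> n) (classes \<rho> n)"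
  using g by (simp add: Aut0_def)

lemma Aut0_cle_iff: "\<alpha> \<in> classes \<rho> n \<Longrightarrow> \<beta> \<in> classes \<rho> n \<Longrightarrow> cle \<rho> (g \<alpha>) (g \<beta>) \<longleftrightarrow> cle \<rho> \<alpha> \<beta>"
  using g by (simp add: Aut0_def)

lemma Aut0_card: "\<alpha> \<in> classes \<rho> n \<Longrightarrow> card (g \<alpha>) = card \<alpha>"
  using g by (simp add: Aut0_def)

lemma Aut0_cls: "i < n \<Longrightarrow> \<exists>m<n. g (cls \<rho> n i) = cls \<rho> n m"
  using Aut0_bij cls_in_classes by (auto simp: bij_betw_def classes_iff)

lemma card_less_in_cls_less:
  "i < n \<Longrightarrow> card {j \<in> cls \<rho> n i. j < i} < card (g (cls \<rho> n i))"
  using card_less_in_less_card[OF finite_cls mem_cls_self] Aut0_card[OF cls_in_classes] by simp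

lemma gtilde_mem: assumes i: "i < n" shows "gtilde \<rho> n g i \<in> g (cls \<rho> n i)"
proof -
  obtain m where "g (cls \<rho> n i) = cls \<rho> n m" using Aut0_cls[OF i] by auto
  then have "finite (g (cls \<rho> n i))" by (simp add: finite_cls)
  then show ?thesis
    unfolding gtilde_def by (rule nth_sorted_list_of_set_in[OF _ card_less_in_cls_less[OF i]])
qed

lemma cls_gtilde: assumes i: "i < n" shows "cls \<rho> n (gtilde \<rho> n g i) = g (cls \<rho> n i)"
proof -
  obtain m where m: "m < n" "g (cls \<rho> n i) = cls \<rho> n m" using Aut0_cls[OF i] by auto
  show ?thesis using cls_eq_of_mem[OF m(1)] gtilde_mem[OF i] m(2) by simp
qed

lemma gtilde_less: assumes i: "i < n" shows "gtilde \<rho> n g i < n"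
proof -
  have "gtilde \<rho> n g i \<in> cls \<rho> n (gtilde \<rho> n g i)" using gtilde_mem[OF i] cls_gtilde[OF i] by simp
  then show ?thesis by (rule less_of_mem_cls)
qed

lemma inj_on_gtilde: "inj_on (gtilde \<rho> n g) {0..<n}"
proof (rule inj_onI)
  fix i j assume "i \<in> {0..<n}" "j \<in> {0..<n}" and eq: "gtilde \<rho> n g i = gtilde \<rho> n g j"
  then have i: "i < n" and j: "j < n" by auto
  have "g (cls \<rho> n i) = g (cls \<rho> n j)" using cls_gtilde[OF i] cls_gtilde[OF j] eq by simp
  then have same: "cls \<rho> n i = cls \<rho> n j"
    using Aut0_bij cls_in_classes[OF i] cls_in_classes[OF j] by (auto simp: bij_betw_def inj_on_def)
  obtain m where m: "g (cls \<rho> n i) = cls \<rho> n m" using Aut0_cls[OF i] by auto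
  have "sorted_list_of_set (g (cls \<rho> n i)) ! card {x \<in> cls \<rho> n i. x < i}
      = sorted_list_of_set (g (cls \<rho> n i)) ! card {x \<in> cls \<rho> n i. x < j}"
    using eq same by (simp add: gtilde_def)
  then have "card {x \<in> cls \<rho> n i. x < i} = card {x \<in> cls \<rho> n i. x < j}"
    using nth_sorted_list_of_set_inj[of "g (cls \<rho> n i)"] m finite_cls
      card_less_in_cls_less[OF i] card_less_in_cls_less[OF j] same by simp
  then show "i = j" using card_less_in_inj[OF finite_cls mem_cls_self[OF i]] mem_cls_self[OF j] same by simp
qed

lemma bij_gtilde: "bij_betw (gtilde \<rho> n g) {0..<n} {0..<n}"
  using gtilde_less inj_on_gtilde by (intro endo_inj_bij_betw) auto

end

lemma preorder_auto_image_cls: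
  assumes k: "preorder_auto \<rho> n k" and i: "i < n"
  shows "k ` cls \<rho> n i = cls \<rho> n (k i)"
proof -
  have kb: "bij_betw k {0..<n} {0..<n}" and kr: "\<And>a b. a < n \<Longrightarrow> b < n \<Longrightarrow> \<rho> (k a) (k b) \<longleftrightarrow> \<rho> a b"
    using k by (auto simp: preorder_auto_def)
  have klt: "j < n \<Longrightarrow> k j < n" for j using kb by (auto simp: bij_betw_def)
  show ?thesis
  proof (intro equalityI subsetI)
    fix y assume "y \<in> k ` cls \<rho> n i"
    then obtain j where "j < n" "\<rho> i j" "\<rho> j i" "y = k j" by (auto simp: cls_def)
    then show "y \<in> cls \<rho> n (k i)" using kr[OF i] kr[OF _ i] klt by (simp add: cls_def)
  next
    fix y assume y: "y \<in> cls \<rho> n (k i)"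
    then have "y \<in> k ` {0..<n}" using kb less_of_mem_cls by (simp add: bij_betw_def)
    then obtain j where j: "j < n" "y = k j" by auto
    then have "j \<in> cls \<rho> n i" using y kr[OF i j(1)] kr[OF j(1) i] by (simp add: cls_def)
    then show "y \<in> k ` cls \<rho> n i" using j by simp
  qed
qed

lemma preorder_auto_Aut0:
  assumes k: "preorder_auto \<rho> n k" shows "(`) k \<in> Aut0 \<rho> n"
proof -
  have kb: "bij_betw k {0..<n} {0..<n}" and kr: "\<And>a b. a < n \<Longrightarrow> b < n \<Longrightarrow> \<rho> (k a) (k b) \<longleftrightarrow> \<rho> a b"
    using k by (auto simp: preorder_auto_def)
  have klt: "a < n \<Longrightarrow> k a < n" for a using kb by (auto simp: bij_betw_def)
  have img: "k ` cls \<rho> n i = cls \<rho> n (k i)" if "i < n" for i by (rule preorder_auto_image_cls[OF k that])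
  have inj: "inj_on ((`) k) (classes \<rho> n)"
  proof (rule inj_onI)
    fix \<alpha> \<beta> assume "\<alpha> \<in> classes \<rho> n" "\<beta> \<in> classes \<rho> n" "k ` \<alpha> = k ` \<beta>"
    then obtain i j where "i < n" "j < n" "\<alpha> = cls \<rho> n i" "\<beta> = cls \<rho> n j" "cls \<rho> n (k i) = cls \<rho> n (k j)"
      using img by (auto simp: classes_iff)
    then show "\<alpha> = \<beta>" using cls_eq_iff[OF klt klt] cls_eq_iff kr by simp
  qed
  have onto: "(`) k ` classes \<rho> n = classes \<rho> n"
  proof (intro equalityI subsetI)
    fix \<beta> assume "\<beta> \<in> (`) k ` classes \<rho> n"
    then obtain i where "i < n" "\<beta> = k ` cls \<rho> n i" by (auto simp: classes_iff)
    then show "\<beta> \<in> classes \<rho> n" using img klt cls_in_classes by simp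
  next
    fix \<beta> assume "\<beta> \<in> classes \<rho> n"
    then obtain m where m: "m < n" "\<beta> = cls \<rho> n m" by (auto simp: classes_iff)
    then obtain i where "i < n" "m = k i" using kb by (force simp: bij_betw_def)
    then have "\<beta> = k ` cls \<rho> n i" using m img by simp
    then show "\<beta> \<in> (`) k ` classes \<rho> n" using cls_in_classes[OF \<open>i < n\<close>] by blast
  qed
  have cle: "cle \<rho> (k ` \<alpha>) (k ` \<beta>) \<longleftrightarrow> cle \<rho> \<alpha> \<beta>" if "\<alpha> \<in> classes \<rho> n" "\<beta> \<in> classes \<rho> n" for \<alpha> \<beta>
    using that img kr klt cle_cls_iff by (auto simp: classes_iff)
  have card: "card (k ` \<alpha>) = card \<alpha>" if "\<alpha> \<in> classes \<rho> n" for \<alpha>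
    using that inj_on_subset[OF bij_betw_imp_inj_on[OF kb]] cls_subset
    by (auto simp: classes_iff intro: card_image)
  show ?thesis using inj onto cle card by (simp add: Aut0_def bij_betw_def)
qed

lemma restrict_permutes_cls:
  assumes k: "bij_betw k {0..<n} {0..<n}" and t: "bij_betw t {0..<n} {0..<n}"
    and same: "\<And>i. i < n \<Longrightarrow> cls \<rho> n (k i) = cls \<rho> n (t i)"
    and \<beta>: "\<beta> \<in> classes \<rho> n"
  shows "restrict_id (k \<circ> inv_into {0..<n} t) \<beta> permutes \<beta>"
proof (rule permutes_restrict_id, rule endo_inj_bij_betw)
  obtain m where m: "m < n" "\<beta> = cls \<rho> n m" using \<beta> by (auto simp: classes_iff)
  have sub: "\<beta> \<subseteq> {0..<n}" using m cls_subset by simp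
  have tinv: "inv_into {0..<n} t y < n" "t (inv_into {0..<n} t y) = y" if "y < n" for y
    using that t bij_betw_inv_into_left[OF bij_betw_inv_into[OF t]] bij_betw_apply[OF bij_betw_inv_into[OF t]]
    by (auto simp: bij_betw_def f_inv_into_f)
  show "finite \<beta>" using m finite_cls by simp
  show "(k \<circ> inv_into {0..<n} t) ` \<beta> \<subseteq> \<beta>"
  proof
    fix x assume "x \<in> (k \<circ> inv_into {0..<n} t) ` \<beta>"
    then obtain y where y: "y \<in> \<beta>" "x = k (inv_into {0..<n} t y)" by auto
    then have yn: "y < n" using sub by auto
    have "cls \<rho> n x = cls \<rho> n y" using same[OF tinv(1)[OF yn]] tinv(2)[OF yn] y by simp
    also have "\<dots> = \<beta>" using cls_eq_of_mem m y by simp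
    finally have "cls \<rho> n x = \<beta>" .
    moreover have "x < n" using y(2) k tinv(1)[OF yn] by (auto simp: bij_betw_def)
    ultimately show "x \<in> \<beta>" using mem_cls_self by blast
  qed
  show "inj_on (k \<circ> inv_into {0..<n} t) \<beta>"
    using inj_on_subset[OF bij_betw_imp_inj_on[OF bij_betw_trans[OF bij_betw_inv_into[OF t] k]] sub] .
qed

lemma orbit_of_preorder_auto:
  assumes k: "preorder_auto \<rho> n k" and deg: "elementary_degrees_agree \<rho> n (h \<circ> k) h'"
  shows "\<exists>\<psi> g \<sigma>. (\<forall>\<alpha>\<in>classes \<rho> n. \<psi> \<alpha> permutes \<alpha>) \<and> g \<in> Aut0 \<rho> n \<and>
    (\<forall>i<n. h' i = h (\<psi> (g (cls \<rho> n i)) (gtilde \<rho> n g i)) + \<sigma> (component \<rho> n (cls \<rho> n i)))"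
proof -
  let ?g = "(`) k" let ?t = "gtilde \<rho> n ((`) k)"
  define \<psi> where "\<psi> \<beta> = restrict_id (k \<circ> inv_into {0..<n} ?t) \<beta>" for \<beta>
  have g: "?g \<in> Aut0 \<rho> n" by (rule preorder_auto_Aut0[OF k])
  have kb: "bij_betw k {0..<n} {0..<n}" using k by (simp add: preorder_auto_def)
  have same_cls: "cls \<rho> n (k i) = cls \<rho> n (?t i)" if "i < n" for i
    using cls_gtilde[OF g that] preorder_auto_image_cls[OF k that] by simp
  have \<psi>: "\<forall>\<beta>\<in>classes \<rho> n. \<psi> \<beta> permutes \<beta>"
    unfolding \<psi>_def using restrict_permutes_cls[OF kb bij_gtilde[OF g] same_cls] by blast
  have \<psi>_gtilde: "\<psi> (?g (cls \<rho> n i)) (?t i) = k i" if i: "i < n" for i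
    using gtilde_mem[OF g i] inv_into_f_f[OF inj_on_gtilde[OF g]] i by (simp add: \<psi>_def restrict_id_def)
  have "\<exists>\<sigma>. \<forall>i<n. - h (k i) + h' i = \<sigma> (component \<rho> n (cls \<rho> n i))"
    using deg by (intro ex_function_of_component)
      (simp add: elementary_degrees_agree_def diff_eq_diff_iff_minus_add_eq)
  then obtain \<sigma> where \<sigma>: "\<forall>i<n. - h (k i) + h' i = \<sigma> (component \<rho> n (cls \<rho> n i))" ..
  have "\<forall>i<n. h' i = h (\<psi> (?g (cls \<rho> n i)) (?t i)) + \<sigma> (component \<rho> n (cls \<rho> n i))"
    using \<psi>_gtilde \<sigma>[rule_format, symmetric] by simp
  then show ?thesis using \<psi> g by blast
qed

lemma preorder_auto_of_orbit:
  assumes \<psi>: "\<forall>\<alpha>\<in>classes \<rho> n. \<psi> \<alpha> permutes \<alpha>" and g: "g \<in> Aut0 \<rho> n"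
    and h': "\<forall>i<n. h' i = h (\<psi> (g (cls \<rho> n i)) (gtilde \<rho> n g i)) + \<sigma> (component \<rho> n (cls \<rho> n i))"
  shows "\<exists>k. preorder_auto \<rho> n k \<and> elementary_degrees_agree \<rho> n (h \<circ> k) h'"
proof -
  define k where "k i = \<psi> (g (cls \<rho> n i)) (gtilde \<rho> n g i)" for i
  have g_cls: "g (cls \<rho> n i) \<in> classes \<rho> n" if "i < n" for i
    using Aut0_bij[OF g] cls_in_classes[OF that] by (auto simp: bij_betw_def)
  have k_mem: "k i \<in> g (cls \<rho> n i)" if "i < n" for i
    using permutes_in_image[OF bspec[OF \<psi> g_cls[OF that]]] gtilde_mem[OF g that] by (simp add: k_def)
  have k_mem_cls: "k i \<in> cls \<rho> n (gtilde \<rho> n g i)" if "i < n" for i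
    using k_mem[OF that] cls_gtilde[OF g that] by simp
  have cls_k: "cls \<rho> n (k i) = g (cls \<rho> n i)" if "i < n" for i
    using cls_eq_of_mem[OF gtilde_less[OF g that] k_mem_cls[OF that]] cls_gtilde[OF g that] by simp
  have k_less: "k i < n" if "i < n" for i
    using k_mem_cls[OF that] by (rule less_of_mem_cls)
  have "inj_on k {0..<n}"
  proof (rule inj_onI)
    fix i j assume "i \<in> {0..<n}" "j \<in> {0..<n}" and eq: "k i = k j"
    then have i: "i < n" and j: "j < n" by auto
    have "g (cls \<rho> n i) = g (cls \<rho> n j)" using cls_k[OF i] cls_k[OF j] eq by simp
    then have same: "cls \<rho> n i = cls \<rho> n j"
      using Aut0_bij[OF g] cls_in_classes[OF i] cls_in_classes[OF j] by (auto simp: bij_betw_def inj_on_def)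
    have "gtilde \<rho> n g i = gtilde \<rho> n g j"
      using eq same permutes_inj[OF bspec[OF \<psi> g_cls[OF i]]] by (simp add: k_def inj_eq)
    then show "i = j" using inj_on_gtilde[OF g] i j by (auto simp: inj_on_def)
  qed
  then have kb: "bij_betw k {0..<n} {0..<n}" using k_less by (intro endo_inj_bij_betw) auto
  have kr: "\<rho> (k a) (k b) \<longleftrightarrow> \<rho> a b" if a: "a < n" and b: "b < n" for a b
    using cle_cls_iff[OF a b] cle_cls_iff[OF k_less[OF a] k_less[OF b]]
      Aut0_cle_iff[OF g cls_in_classes[OF a] cls_in_classes[OF b]] cls_k[OF a] cls_k[OF b] by simp
  have "h (k a) - h (k b) = h' a - h' b" if a: "a < n" and b: "b < n" and "\<rho> a b" for a b
    using h' a b component_eq_if_rel[OF a b \<open>\<rho> a b\<close>] unfolding k_def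
    by (simp only: diff_conv_add_uminus minus_add add.assoc add_minus_cancel)
  then show ?thesis using kb kr by (auto simp: preorder_auto_def elementary_degrees_agree_def)
qed

lemma orbit_iff_preorder_auto:
  "(\<exists>\<psi> g \<sigma>. (\<forall>\<alpha>\<in>classes \<rho> n. \<psi> \<alpha> permutes \<alpha>) \<and> g \<in> Aut0 \<rho> n \<and>
      (\<forall>i<n. h' i = h (\<psi> (g (cls \<rho> n i)) (gtilde \<rho> n g i)) + \<sigma> (component \<rho> n (cls \<rho> n i))))
   \<longleftrightarrow> (\<exists>k. preorder_auto \<rho> n k \<and> elementary_degrees_agree \<rho> n (h \<circ> k) h')"
proof
  assume "\<exists>\<psi> g \<sigma>. (\<forall>\<alpha>\<in>classes \<rho> n. \<psi> \<alpha> permutes \<alpha>) \<and> g \<in> Aut0 \<rho> n \<and>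
      (\<forall>i<n. h' i = h (\<psi> (g (cls \<rho> n i)) (gtilde \<rho> n g i)) + \<sigma> (component \<rho> n (cls \<rho> n i)))"
  then obtain \<psi> g \<sigma> where "\<forall>\<alpha>\<in>classes \<rho> n. \<psi> \<alpha> permutes \<alpha>" "g \<in> Aut0 \<rho> n"
    "\<forall>i<n. h' i = h (\<psi> (g (cls \<rho> n i)) (gtilde \<rho> n g i)) + \<sigma> (component \<rho> n (cls \<rho> n i))"
    by blast
  then show "\<exists>k. preorder_auto \<rho> n k \<and> elementary_degrees_agree \<rho> n (h \<circ> k) h'"
    by (rule preorder_auto_of_orbit)
next
  assume "\<exists>k. preorder_auto \<rho> n k \<and> elementary_degrees_agree \<rho> n (h \<circ> k) h'"
  then obtain k where "preorder_auto \<rho> n k" "elementary_degrees_agree \<rho> n (h \<circ> k) h'" by blast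
  then show "\<exists>\<psi> g \<sigma>. (\<forall>\<alpha>\<in>classes \<rho> n. \<psi> \<alpha> permutes \<alpha>) \<and> g \<in> Aut0 \<rho> n \<and>
      (\<forall>i<n. h' i = h (\<psi> (g (cls \<rho> n i)) (gtilde \<rho> n g i)) + \<sigma> (component \<rho> n (cls \<rho> n i)))"
    by (rule orbit_of_preorder_auto)
qed

lemma ex_preorder_auto_if_monotone_bij:
  assumes \<pi>: "bij_betw \<pi> {0..<n} {0..<n}" and mono: "\<forall>i<n. \<forall>j<n. \<rho> i j \<longrightarrow> \<rho> (\<pi> i) (\<pi> j)"
    and deg: "elementary_degrees_agree \<rho> n h (h' \<circ> \<pi>)"
  shows "\<exists>k. preorder_auto \<rho> n k \<and> elementary_degrees_agree \<rho> n (h \<circ> k) h'"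
proof -
  define k where "k = inv_into {0..<n} \<pi>"
  have kb: "bij_betw k {0..<n} {0..<n}" unfolding k_def by (rule bij_betw_inv_into[OF \<pi>])
  have k_less: "a < n \<Longrightarrow> k a < n" for a using kb by (auto simp: bij_betw_def)
  have \<pi>_k: "a < n \<Longrightarrow> \<pi> (k a) = a" for a unfolding k_def using \<pi> by (simp add: bij_betw_def f_inv_into_f)
  have kr: "\<rho> (k a) (k b) \<longleftrightarrow> \<rho> a b" if a: "a < n" and b: "b < n" for a b
  proof
    assume "\<rho> (k a) (k b)"
    then have "\<rho> (\<pi> (k a)) (\<pi> (k b))" using mono k_less[OF a] k_less[OF b] by blast
    then show "\<rho> a b" using \<pi>_k[OF a] \<pi>_k[OF b] by simp
  next
    assume "\<rho> a b"
    then show "\<rho> (k a) (k b)"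
      using bij_betw_reflects_rel[of "{0..<n}" \<pi> \<rho> "k a" "k b"] \<pi> mono k_less[OF a] k_less[OF b]
        \<pi>_k[OF a] \<pi>_k[OF b] by simp
  qed
  have "h (k a) - h (k b) = h' a - h' b" if a: "a < n" and b: "b < n" and "\<rho> a b" for a b
    using deg[unfolded elementary_degrees_agree_def, rule_format, OF k_less[OF a] k_less[OF b]]
      kr[OF a b] \<open>\<rho> a b\<close> \<pi>_k[OF a] \<pi>_k[OF b] by simp
  then show ?thesis using kb kr by (auto simp: preorder_auto_def elementary_degrees_agree_def)
qed

end

section \<open>Coordinates and matrix units\<close>

locale finite_basis = vector_space scale
  for scale :: "'k::field \<Rightarrow> 'v::ab_group_add \<Rightarrow> 'v" (infixr \<open>*s\<close> 75) +
  fixes n :: nat and v :: "nat \<Rightarrow> 'v"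
  assumes inj: "inj_on v {0..<n}"
    and indep: "\<not> dependent (v ` {0..<n})"
    and spans: "span (v ` {0..<n}) = UNIV"
begin

abbreviation lin where
  "lin f \<equiv> Vector_Spaces.linear (*s) (*s) f"

lemma lin_iff: "lin f \<longleftrightarrow> (\<forall>x y. f (x + y) = f x + f y) \<and> (\<forall>c x. f (c *s x) = c *s f x)"
  using Vector_Spaces.linear_iff[of "(*s)" "(*s)" f] vector_space_axioms by auto

lemma lin_add: "lin f \<Longrightarrow> f (x + y) = f x + f y"
  by (simp add: lin_iff)

lemma lin_scale: "lin f \<Longrightarrow> f (c *s x) = c *s f x"
  by (simp add: lin_iff)

lemma lin_zero: "lin f \<Longrightarrow> f 0 = 0"
  using lin_scale[of f 0 0] by simp

lemma lin_sum: "lin f \<Longrightarrow> f (\<Sum>i\<in>I. g i) = (\<Sum>i\<in>I. f (g i))"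
  by (induction I rule: infinite_finite_induct) (auto simp: lin_add lin_zero)

lemma lin_comp: "lin f \<Longrightarrow> lin g \<Longrightarrow> lin (f \<circ> g)"
  by (simp add: lin_iff)

lemma lin_plus: "lin f \<Longrightarrow> lin g \<Longrightarrow> lin (\<lambda>x. f x + g x)"
  by (simp add: lin_iff scale_right_distrib algebra_simps)

lemma lin_const_zero: "lin (\<lambda>x. 0)"
  by (simp add: lin_iff)

text \<open>Both scalars describe \<open>p q p q\<close>, so \<open>c = d\<close> unless \<open>p \<circ> q = 0\<close>.\<close>
lemma sandwich_scalars_zero_iff:
  assumes lp: "lin p" and lq: "lin q"
    and pn: "p \<noteq> (\<lambda>x. 0)" and qn: "q \<noteq> (\<lambda>x. 0)"
    and d: "p \<circ> q \<circ> p = (\<lambda>x. d *s p x)" and c: "q \<circ> p \<circ> q = (\<lambda>x. c *s q x)"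
  shows "c = 0 \<longleftrightarrow> d = 0"
proof -
  have d': "p (q (p x)) = d *s p x" for x using fun_cong[OF d, of x] by simp
  have c': "q (p (q x)) = c *s q x" for x using fun_cong[OF c, of x] by simp
  have eq: "d *s p (q x) = c *s p (q x)" for x
  proof -
    have "p (q (p (q x))) = p (c *s q x)" using c'[of x] by simp
    also have "\<dots> = c *s p (q x)" by (rule lin_scale[OF lp])
    finally show ?thesis using d'[of "q x"] by simp
  qed
  obtain x0 where x0: "p x0 \<noteq> 0" using pn by auto
  obtain y0 where y0: "q y0 \<noteq> 0" using qn by auto
  show ?thesis
  proof (cases "\<exists>x. p (q x) \<noteq> 0")
    case True
    then obtain x where "p (q x) \<noteq> 0" by auto
    then have "c = d" using eq[of x] by simp
    then show ?thesis by simp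
  next
    case False
    then have "d *s p x0 = 0" using d'[of x0] by simp
    then have "d = 0" using x0 by simp
    moreover have "c *s q y0 = 0" using c'[of y0] False lin_zero[OF lq] by simp
    then have "c = 0" using y0 by simp
    ultimately show ?thesis by simp
  qed
qed

definition coord :: "nat \<Rightarrow> 'v \<Rightarrow> 'k" where
  "coord a u = representation (v ` {0..<n}) u (v a)"

lemma in_span_basis: "x \<in> span (v ` {0..<n})"
  using spans by simp

lemma coord_add: "coord a (x + y) = coord a x + coord a y"
  unfolding coord_def using representation_add[OF indep in_span_basis in_span_basis] by simp

lemma coord_scale: "coord a (c *s x) = c * coord a x"
  unfolding coord_def using representation_scale[OF indep in_span_basis] by simp

lemma coord_zero [simp]: "coord a 0 = 0"
  unfolding coord_def by (simp add: representation_zero)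

lemma coord_sum: "coord a (\<Sum>i\<in>I. f i) = (\<Sum>i\<in>I. coord a (f i))"
  by (induction I rule: infinite_finite_induct) (auto simp: coord_add)

lemma coord_basis: assumes "a < n" "b < n" shows "coord a (v b) = (if a = b then 1 else 0)"
proof -
  have "coord a (v b) = (if v a = v b then 1 else 0)"
    unfolding coord_def using representation_basis[OF indep] assms by simp
  moreover have "v a = v b \<longleftrightarrow> a = b" using inj assms by (auto simp: inj_on_def)
  ultimately show ?thesis by simp
qed

lemma basis_expansion: "x = (\<Sum>b<n. coord b x *s v b)"
proof -
  have "(\<Sum>w\<in>v ` {0..<n}. representation (v ` {0..<n}) x w *s w) = x"
    by (rule sum_representation_eq[OF indep in_span_basis]) auto
  then show ?thesis
    unfolding coord_def using inj by (simp add: sum.reindex lessThan_atLeast0)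
qed

lemma coord_eqI: "(\<And>a. a < n \<Longrightarrow> coord a x = coord a y) \<Longrightarrow> x = y"
  by (subst basis_expansion, subst (2) basis_expansion) simp

lemma basis_nonzero: "a < n \<Longrightarrow> v a \<noteq> 0"
  using coord_basis[of a a] by auto

lemma in_span_basis_subset_iff:
  assumes S: "S \<subseteq> {0..<n}"
  shows "x \<in> span (v ` S) \<longleftrightarrow> (\<forall>a<n. coord a x \<noteq> 0 \<longrightarrow> a \<in> S)"
proof
  assume x: "x \<in> span (v ` S)"
  show "\<forall>a<n. coord a x \<noteq> 0 \<longrightarrow> a \<in> S"
  proof (intro allI impI)
    fix a assume a: "a < n" "coord a x \<noteq> 0"
    have "representation (v ` {0..<n}) x = representation (v ` S) x"
      by (rule representation_extend[OF indep x]) (use S in auto)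
    then have "representation (v ` S) x (v a) \<noteq> 0" using a by (simp add: coord_def)
    then have "v a \<in> v ` S" by (rule representation_ne_zero)
    then obtain b where b: "b \<in> S" "v a = v b" by auto
    then have "a = b" using inj a S by (auto simp: inj_on_def)
    then show "a \<in> S" using b by simp
  qed
next
  assume H: "\<forall>a<n. coord a x \<noteq> 0 \<longrightarrow> a \<in> S"
  have "(\<Sum>b<n. coord b x *s v b) \<in> span (v ` S)"
  proof (rule span_sum)
    fix b assume "b \<in> {..<n}"
    then show "coord b x *s v b \<in> span (v ` S)"
      using H by (cases "coord b x = 0") (auto intro: span_scale span_base span_zero)
  qed
  then show "x \<in> span (v ` S)" using basis_expansion[of x] by simp
qed

definition entry :: "('v \<Rightarrow> 'v) \<Rightarrow> nat \<Rightarrow> nat \<Rightarrow> 'k" where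
  "entry f a b = coord a (f (v b))"

lemma lin_basis_expansion: "lin f \<Longrightarrow> f x = (\<Sum>b<n. coord b x *s f (v b))"
  by (subst basis_expansion) (simp add: lin_sum lin_scale)

lemma coord_lin: "lin f \<Longrightarrow> coord a (f x) = (\<Sum>b<n. coord b x * entry f a b)"
  by (subst lin_basis_expansion) (auto simp: coord_sum coord_scale entry_def)

lemma entry_plus: "entry (\<lambda>x. f x + g x) a b = entry f a b + entry g a b"
  by (simp add: entry_def coord_add)

lemma nonzero_coord_lin:
  assumes "lin f" "coord a (f x) \<noteq> 0"
  obtains b where "b < n" "coord b x \<noteq> 0" "entry f a b \<noteq> 0"
proof -
  have "(\<Sum>b<n. coord b x * entry f a b) \<noteq> 0" using assms coord_lin by simp
  then obtain b where "b < n" "coord b x * entry f a b \<noteq> 0"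
    using sum.not_neutral_contains_not_neutral by blast
  then show thesis using that by simp
qed

lemma nonzero_entry_of_comp:
  assumes "lin f" "entry (f \<circ> g) a b \<noteq> 0"
  obtains c where "c < n" "entry g c b \<noteq> 0" "entry f a c \<noteq> 0"
  using nonzero_coord_lin[of f a "g (v b)"] assms by (auto simp: entry_def)

definition matrix_unit :: "nat \<Rightarrow> nat \<Rightarrow> 'v \<Rightarrow> 'v" where
  "matrix_unit a b u = coord b u *s v a"

lemma lin_matrix_unit: "lin (matrix_unit a b)"
  by (simp add: lin_iff matrix_unit_def coord_add coord_scale scale_left_distrib)

lemma entry_matrix_unit:
  "c < n \<Longrightarrow> d < n \<Longrightarrow> a < n \<Longrightarrow> b < n \<Longrightarrow> entry (matrix_unit a b) c d = (if c = a \<and> d = b then 1 else 0)"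
  by (simp add: entry_def matrix_unit_def coord_scale coord_basis)

lemma matrix_unit_nonzero: assumes "a < n" "b < n" shows "matrix_unit a b \<noteq> (\<lambda>x. 0)"
proof
  assume "matrix_unit a b = (\<lambda>x. 0)"
  then have "matrix_unit a b (v b) = 0" by simp
  then show False using assms basis_nonzero[of a] by (simp add: matrix_unit_def coord_basis)
qed

lemma sum_diagonal_units: "(\<lambda>x. \<Sum>a<n. matrix_unit a a x) = id"
  by (rule ext) (simp add: matrix_unit_def basis_expansion[symmetric])

lemma diagonal_unit_idem: "a < n \<Longrightarrow> matrix_unit a a \<circ> matrix_unit a a = matrix_unit a a"
  by (rule ext) (simp add: matrix_unit_def coord_scale coord_basis)

lemma diagonal_units_sandwich:
  "lin f \<Longrightarrow> matrix_unit a a \<circ> f \<circ> matrix_unit b b = (\<lambda>x. entry f a b *s matrix_unit a b x)"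
  by (rule ext) (simp add: matrix_unit_def lin_scale coord_scale entry_def mult.commute)

end

section \<open>\<open>END(F)\<close> as an incidence algebra\<close>

locale flag_basis = finite_basis scale n v + index_preorder \<rho> n
  for scale :: "'k::field \<Rightarrow> 'v::ab_group_add \<Rightarrow> 'v" (infixr \<open>*s\<close> 75)
    and n :: nat and v :: "nat \<Rightarrow> 'v" and \<rho> :: "nat \<Rightarrow> nat \<Rightarrow> bool"
begin

abbreviation END where "END \<equiv> ENDF \<rho> n (*s) v"

lemma Vflag_cls: assumes i: "i < n"
  shows "Vflag \<rho> n (*s) v (cls \<rho> n i) = {x. \<forall>a<n. coord a x \<noteq> 0 \<longrightarrow> \<rho> a i}"
proof -
  have sub: "{a. a < n \<and> cle \<rho> (cls \<rho> n a) (cls \<rho> n i)} \<subseteq> {0..<n}" by auto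
  have "x \<in> span (v ` {a. a < n \<and> cle \<rho> (cls \<rho> n a) (cls \<rho> n i)}) \<longleftrightarrow> (\<forall>a<n. coord a x \<noteq> 0 \<longrightarrow> \<rho> a i)"
    for x
    unfolding in_span_basis_subset_iff[OF sub] using cle_cls_iff i by auto
  then show ?thesis unfolding Vflag_def by auto
qed

lemma Vdeg_eq: "Vdeg n (*s) v h x = {u. \<forall>a<n. coord a u \<noteq> 0 \<longrightarrow> h a = x}"
proof -
  have sub: "{i. i < n \<and> h i = x} \<subseteq> {0..<n}" by auto
  have "u \<in> span (v ` {i. i < n \<and> h i = x}) \<longleftrightarrow> (\<forall>a<n. coord a u \<noteq> 0 \<longrightarrow> h a = x)" for u
    using in_span_basis_subset_iff[OF sub] by auto
  then show ?thesis unfolding Vdeg_def by auto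
qed

lemma mem_END_iff: "f \<in> END \<longleftrightarrow> lin f \<and> (\<forall>a<n. \<forall>b<n. entry f a b \<noteq> 0 \<longrightarrow> \<rho> a b)"
proof
  assume f: "f \<in> END"
  then have l: "lin f" by (simp add: ENDF_def)
  show "lin f \<and> (\<forall>a<n. \<forall>b<n. entry f a b \<noteq> 0 \<longrightarrow> \<rho> a b)"
  proof (intro conjI l allI impI)
    fix a b assume ab: "a < n" "b < n" "entry f a b \<noteq> 0"
    have "f ` Vflag \<rho> n (*s) v (cls \<rho> n b) \<subseteq> Vflag \<rho> n (*s) v (cls \<rho> n b)"
      using f cls_in_classes[OF ab(2)] by (simp add: ENDF_def)
    moreover have "v b \<in> Vflag \<rho> n (*s) v (cls \<rho> n b)"
      using ab refl by (auto simp: Vflag_cls coord_basis)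
    ultimately have "f (v b) \<in> Vflag \<rho> n (*s) v (cls \<rho> n b)" by auto
    then show "\<rho> a b" using ab by (auto simp: Vflag_cls entry_def)
  qed
next
  assume H: "lin f \<and> (\<forall>a<n. \<forall>b<n. entry f a b \<noteq> 0 \<longrightarrow> \<rho> a b)"
  show "f \<in> END"
    unfolding ENDF_def
  proof (intro CollectI conjI ballI)
    show "lin f" using H by simp
    fix \<alpha> assume "\<alpha> \<in> classes \<rho> n"
    then obtain i where i: "i < n" "\<alpha> = cls \<rho> n i" by (auto simp: classes_iff)
    show "f ` Vflag \<rho> n (*s) v \<alpha> \<subseteq> Vflag \<rho> n (*s) v \<alpha>"
    proof
      fix y assume "y \<in> f ` Vflag \<rho> n (*s) v \<alpha>"
      then obtain x where x: "x \<in> Vflag \<rho> n (*s) v \<alpha>" "y = f x" by auto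
      have "\<rho> a i" if a: "a < n" "coord a (f x) \<noteq> 0" for a
      proof -
        obtain b where b: "b < n" "coord b x \<noteq> 0" "entry f a b \<noteq> 0"
          using nonzero_coord_lin H a(2) by blast
        then have "\<rho> a b" "\<rho> b i" using H a x i by (auto simp: Vflag_cls)
        then show "\<rho> a i" using rel_trans a(1) b(1) i by blast
      qed
      then show "y \<in> Vflag \<rho> n (*s) v \<alpha>" using x i by (simp add: Vflag_cls)
    qed
  qed
qed

lemma mem_ENDdeg_iff:
  "f \<in> ENDdeg \<rho> n (*s) v h \<sigma> \<longleftrightarrow> f \<in> END \<and> (\<forall>a<n. \<forall>b<n. entry f a b \<noteq> 0 \<longrightarrow> h a = \<sigma> + h b)"
proof
  assume f: "f \<in> ENDdeg \<rho> n (*s) v h \<sigma>"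
  then have F: "f \<in> END" by (simp add: ENDdeg_def)
  show "f \<in> END \<and> (\<forall>a<n. \<forall>b<n. entry f a b \<noteq> 0 \<longrightarrow> h a = \<sigma> + h b)"
  proof (intro conjI F allI impI)
    fix a b assume ab: "a < n" "b < n" "entry f a b \<noteq> 0"
    have "v b \<in> Vdeg n (*s) v h (h b)" using ab by (auto simp: Vdeg_eq coord_basis)
    then have "f (v b) \<in> Vdeg n (*s) v h (\<sigma> + h b)" using f by (auto simp: ENDdeg_def)
    then show "h a = \<sigma> + h b" using ab by (auto simp: Vdeg_eq entry_def)
  qed
next
  assume H: "f \<in> END \<and> (\<forall>a<n. \<forall>b<n. entry f a b \<noteq> 0 \<longrightarrow> h a = \<sigma> + h b)"
  then have l: "lin f" by (simp add: ENDF_def)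
  show "f \<in> ENDdeg \<rho> n (*s) v h \<sigma>"
    unfolding ENDdeg_def
  proof (intro CollectI conjI allI)
    show "f \<in> END" using H by simp
    fix y
    show "f ` Vdeg n (*s) v h y \<subseteq> Vdeg n (*s) v h (\<sigma> + y)"
    proof
      fix z assume "z \<in> f ` Vdeg n (*s) v h y"
      then obtain x where x: "x \<in> Vdeg n (*s) v h y" "z = f x" by auto
      have "h a = \<sigma> + y" if a: "a < n" "coord a (f x) \<noteq> 0" for a
      proof -
        obtain b where "b < n" "coord b x \<noteq> 0" "entry f a b \<noteq> 0"
          using nonzero_coord_lin l a(2) by blast
        then show "h a = \<sigma> + y" using H a x by (auto simp: Vdeg_eq)
      qed
      then show "z \<in> Vdeg n (*s) v h (\<sigma> + y)" using x by (simp add: Vdeg_eq)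
    qed
  qed
qed

lemma END_lin: "f \<in> END \<Longrightarrow> lin f"
  by (simp add: ENDF_def)

lemma END_zero: "(\<lambda>x. 0) \<in> END"
  by (simp add: mem_END_iff entry_def lin_const_zero)

lemma END_plus: assumes f: "f \<in> END" and g: "g \<in> END" shows "(\<lambda>x. f x + g x) \<in> END"
  unfolding mem_END_iff
proof (intro conjI allI impI)
  show "lin (\<lambda>x. f x + g x)" using f g by (simp add: END_lin lin_plus)
  fix a b assume ab: "a < n" "b < n" "entry (\<lambda>x. f x + g x) a b \<noteq> 0"
  then show "\<rho> a b" using f g by (cases "entry f a b = 0") (auto simp: entry_plus mem_END_iff)
qed

lemma END_sum: "(\<And>i. i \<in> I \<Longrightarrow> F i \<in> END) \<Longrightarrow> (\<lambda>x. \<Sum>i\<in>I. F i x) \<in> END"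
  by (induction I rule: infinite_finite_induct) (auto simp: END_zero intro!: END_plus)

lemma END_comp: assumes f: "f \<in> END" and g: "g \<in> END" shows "f \<circ> g \<in> END"
proof -
  have l: "lin f" "lin g" using f g by (auto simp: END_lin)
  show ?thesis unfolding mem_END_iff
  proof (intro conjI allI impI lin_comp l)
    fix a b assume ab: "a < n" "b < n" "entry (f \<circ> g) a b \<noteq> 0"
    then obtain c where "c < n" "entry g c b \<noteq> 0" "entry f a c \<noteq> 0"
      using nonzero_entry_of_comp[OF l(1)] by blast
    then show "\<rho> a b" using f g ab rel_trans by (meson mem_END_iff)
  qed
qed

lemma matrix_unit_END: "a < n \<Longrightarrow> b < n \<Longrightarrow> \<rho> a b \<Longrightarrow> matrix_unit a b \<in> END"
  by (auto simp: mem_END_iff entry_matrix_unit lin_matrix_unit split: if_splits)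

lemma matrix_unit_ENDdeg:
  "a < n \<Longrightarrow> b < n \<Longrightarrow> \<rho> a b \<Longrightarrow> matrix_unit a b \<in> ENDdeg \<rho> n (*s) v h (h a - h b)"
  by (auto simp: mem_ENDdeg_iff matrix_unit_END entry_matrix_unit split: if_splits)

section \<open>Graded isomorphisms yield relabellings of the basis\<close>

definition END_automorphism :: "(('v \<Rightarrow> 'v) \<Rightarrow> ('v \<Rightarrow> 'v)) \<Rightarrow> bool" where
  "END_automorphism \<Phi> \<longleftrightarrow> bij_betw \<Phi> END END
      \<and> (\<forall>f\<in>END. \<forall>f'\<in>END. \<Phi> (\<lambda>x. f x + f' x) = (\<lambda>x. \<Phi> f x + \<Phi> f' x) \<and> \<Phi> (f \<circ> f') = \<Phi> f \<circ> \<Phi> f')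
      \<and> (\<forall>c. \<forall>f\<in>END. \<Phi> (\<lambda>x. c *s (f x)) = (\<lambda>x. c *s (\<Phi> f x)))
      \<and> \<Phi> id = id"

lemma graded_END_iso_iff: "graded_END_iso \<rho> n (*s) v h h' \<longleftrightarrow>
   (\<exists>\<Phi>. END_automorphism \<Phi> \<and> (\<forall>\<sigma>. \<Phi> ` ENDdeg \<rho> n (*s) v h \<sigma> = ENDdeg \<rho> n (*s) v h' \<sigma>))"
  unfolding graded_END_iso_def END_automorphism_def by (simp only: conj_assoc)

context
  fixes \<Phi> assumes \<Phi>: "END_automorphism \<Phi>"
begin

lemma auto_bij: "bij_betw \<Phi> END END"
  using \<Phi> by (simp add: END_automorphism_def)

lemma auto_END: "f \<in> END \<Longrightarrow> \<Phi> f \<in> END"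
  using auto_bij by (auto simp: bij_betw_def)

lemma auto_plus: "f \<in> END \<Longrightarrow> g \<in> END \<Longrightarrow> \<Phi> (\<lambda>x. f x + g x) = (\<lambda>x. \<Phi> f x + \<Phi> g x)"
  using \<Phi> by (simp add: END_automorphism_def)

lemma auto_comp: "f \<in> END \<Longrightarrow> g \<in> END \<Longrightarrow> \<Phi> (f \<circ> g) = \<Phi> f \<circ> \<Phi> g"
  using \<Phi> by (simp add: END_automorphism_def)

lemma auto_scale: "f \<in> END \<Longrightarrow> \<Phi> (\<lambda>x. c *s f x) = (\<lambda>x. c *s \<Phi> f x)"
  using \<Phi> by (simp add: END_automorphism_def)

lemma auto_id: "\<Phi> id = id"
  using \<Phi> by (simp add: END_automorphism_def)

lemma auto_zero: "\<Phi> (\<lambda>x. 0) = (\<lambda>x. 0)"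
  using auto_scale[OF END_zero, of 0] by simp

lemma auto_nonzero: assumes f: "f \<in> END" and "f \<noteq> (\<lambda>x. 0)" shows "\<Phi> f \<noteq> (\<lambda>x. 0)"
proof
  assume "\<Phi> f = (\<lambda>x. 0)"
  then have "\<Phi> f = \<Phi> (\<lambda>x. 0)" using auto_zero by simp
  then have "f = (\<lambda>x. 0)" using auto_bij f END_zero by (auto simp: bij_betw_def inj_on_def)
  with \<open>f \<noteq> (\<lambda>x. 0)\<close> show False by simp
qed

lemma auto_sum: "finite I \<Longrightarrow> (\<And>i. i \<in> I \<Longrightarrow> F i \<in> END) \<Longrightarrow>
    \<Phi> (\<lambda>x. \<Sum>i\<in>I. F i x) = (\<lambda>x. \<Sum>i\<in>I. \<Phi> (F i) x)"
proof (induction I rule: finite_induct)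
  case empty
  then show ?case using auto_zero by simp
next
  case (insert i I)
  have "\<Phi> (\<lambda>x. \<Sum>j\<in>insert i I. F j x) = \<Phi> (\<lambda>x. F i x + (\<Sum>j\<in>I. F j x))"
    using insert by simp
  also have "\<dots> = (\<lambda>x. \<Phi> (F i) x + \<Phi> (\<lambda>x. \<Sum>j\<in>I. F j x) x)"
    using auto_plus[of "F i" "\<lambda>x. \<Sum>j\<in>I. F j x"] insert by (simp add: END_sum)
  also have "\<dots> = (\<lambda>x. \<Sum>j\<in>insert i I. \<Phi> (F j) x)" using insert by simp
  finally show ?case .
qed

definition idem :: "nat \<Rightarrow> 'v \<Rightarrow> 'v" where
  "idem i = \<Phi> (matrix_unit i i)"

lemma idem_END: "i < n \<Longrightarrow> idem i \<in> END"
  using refl by (simp add: idem_def auto_END matrix_unit_END)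

lemma idem_lin: "i < n \<Longrightarrow> lin (idem i)"
  using idem_END END_lin by blast

lemma idem_nonzero: "i < n \<Longrightarrow> idem i \<noteq> (\<lambda>x. 0)"
  using auto_nonzero[OF matrix_unit_END matrix_unit_nonzero] refl by (simp add: idem_def)

lemma idem_idem: assumes i: "i < n" shows "idem i (idem i x) = idem i x"
proof -
  have E: "matrix_unit i i \<in> END" using refl i matrix_unit_END by blast
  have "idem i \<circ> idem i = idem i" using auto_comp[OF E E] diagonal_unit_idem[OF i] by (simp add: idem_def)
  then show ?thesis by (metis comp_apply)
qed

lemma sum_idem: "(\<Sum>i<n. idem i x) = x"
proof -
  have "\<Phi> (\<lambda>x. \<Sum>a<n. matrix_unit a a x) = (\<lambda>x. \<Sum>a<n. idem a x)"
    unfolding idem_def using refl by (intro auto_sum) (auto intro: matrix_unit_END)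
  then have "(\<lambda>x. \<Sum>a<n. idem a x) = id" using auto_id sum_diagonal_units by simp
  then show ?thesis by (metis id_apply)
qed

text \<open>\<open>E\<^sub>i\<^sub>i A E\<^sub>i\<^sub>i\<close> is the line spanned by \<open>E\<^sub>i\<^sub>i\<close>, hence so is its image \<open>idem i A idem i\<close>.\<close>
lemma idem_sandwich: assumes i: "i < n" and y: "y \<in> END"
  obtains c where "idem i \<circ> y \<circ> idem i = (\<lambda>x. c *s idem i x)"
proof -
  have "y \<in> \<Phi> ` END" using auto_bij y by (simp add: bij_betw_def)
  then obtain z where z: "z \<in> END" "\<Phi> z = y" by blast
  have E: "matrix_unit i i \<in> END" using refl i by (simp add: matrix_unit_END)
  have "idem i \<circ> y \<circ> idem i = \<Phi> (matrix_unit i i \<circ> z \<circ> matrix_unit i i)"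
    unfolding idem_def using z E by (simp add: auto_comp END_comp)
  also have "matrix_unit i i \<circ> z \<circ> matrix_unit i i = (\<lambda>x. entry z i i *s matrix_unit i i x)"
    using diagonal_units_sandwich[OF END_lin[OF z(1)]] .
  also have "\<Phi> (\<lambda>x. entry z i i *s matrix_unit i i x) = (\<lambda>x. entry z i i *s idem i x)"
    using auto_scale[OF E] by (simp add: idem_def)
  finally show thesis by (rule that)
qed

definition linked :: "nat \<Rightarrow> nat \<Rightarrow> bool" where
  "linked a i \<longleftrightarrow> entry (idem i) a a \<noteq> 0"

lemma linked_iff_sandwich: assumes i: "i < n" and a: "a < n"
  shows "linked a i \<longleftrightarrow> (\<exists>c. c \<noteq> 0 \<and> idem i \<circ> matrix_unit a a \<circ> idem i = (\<lambda>x. c *s idem i x))"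
proof -
  obtain c where c: "idem i \<circ> matrix_unit a a \<circ> idem i = (\<lambda>x. c *s idem i x)"
    using idem_sandwich[OF i matrix_unit_END[OF a a]] refl a by auto
  have "c = 0 \<longleftrightarrow> entry (idem i) a a = 0"
    by (rule sandwich_scalars_zero_iff[OF lin_matrix_unit idem_lin[OF i] matrix_unit_nonzero[OF a a]
          idem_nonzero[OF i] diagonal_units_sandwich[OF idem_lin[OF i]] c])
  moreover have "(\<exists>c'. c' \<noteq> 0 \<and> idem i \<circ> matrix_unit a a \<circ> idem i = (\<lambda>x. c' *s idem i x)) \<longleftrightarrow> c \<noteq> 0"
  proof
    assume "\<exists>c'. c' \<noteq> 0 \<and> idem i \<circ> matrix_unit a a \<circ> idem i = (\<lambda>x. c' *s idem i x)"
    then obtain c' where c': "c' \<noteq> 0" "idem i \<circ> matrix_unit a a \<circ> idem i = (\<lambda>x. c' *s idem i x)" by auto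
    obtain x where x: "idem i x \<noteq> 0" using idem_nonzero[OF i] by auto
    have "c' *s idem i x = c *s idem i x" using fun_cong[OF c, of x] fun_cong[OF c'(2), of x] by auto
    then show "c \<noteq> 0" using x c' by simp
  qed (use c in auto)
  ultimately show ?thesis unfolding linked_def by auto
qed

lemma linked_sandwich: assumes i: "i < n" and a: "a < n" and "linked a i"
  obtains c where "c \<noteq> 0" "\<And>x. idem i (matrix_unit a a (idem i x)) = c *s idem i x"
  using linked_iff_sandwich[OF i a] \<open>linked a i\<close> by (metis comp_apply)

lemma ex_linked: assumes i: "i < n" shows "\<exists>a<n. linked a i"
proof (rule ccontr)
  assume none: "\<not> (\<exists>a<n. linked a i)"
  have zero: "idem i (matrix_unit a a (idem i x)) = 0" if a: "a < n" for a x
  proof -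
    obtain c where c: "idem i \<circ> matrix_unit a a \<circ> idem i = (\<lambda>x. c *s idem i x)"
      using idem_sandwich[OF i matrix_unit_END[OF a a]] refl a by auto
    have "c = 0" using none linked_iff_sandwich[OF i a] c a by blast
    then show ?thesis using fun_cong[OF c, of x] by simp
  qed
  have "idem i x = 0" for x
  proof -
    have "idem i x = idem i (idem i x)" using idem_idem[OF i] by simp
    also have "\<dots> = idem i (\<Sum>a<n. matrix_unit a a (idem i x))"
      using fun_cong[OF sum_diagonal_units, of "idem i x"] by simp
    also have "\<dots> = (\<Sum>a<n. idem i (matrix_unit a a (idem i x)))" by (simp add: lin_sum[OF idem_lin[OF i]])
    also have "\<dots> = 0" using zero by simp
    finally show ?thesis .
  qed
  then show False using idem_nonzero[OF i] by auto
qed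

text \<open>Sandwiching \<open>\<Phi> E\<^sub>i\<^sub>j = idem i \<circ> \<Phi> E\<^sub>i\<^sub>j \<circ> idem j\<close> between \<open>E\<^sub>a\<^sub>a\<close> and \<open>E\<^sub>b\<^sub>b\<close> recovers
  a nonzero multiple of \<open>\<Phi> E\<^sub>i\<^sub>j\<close> from its \<open>(a, b)\<close> entry.\<close>
lemma entry_auto_matrix_unit_nonzero:
  assumes ij: "i < n" "j < n" "\<rho> i j" and ab: "a < n" "b < n" and "linked a i" "linked b j"
  shows "entry (\<Phi> (matrix_unit i j)) a b \<noteq> 0"
proof
  assume zero: "entry (\<Phi> (matrix_unit i j)) a b = 0"
  let ?f = "\<Phi> (matrix_unit i j)"
  have E: "matrix_unit i j \<in> END" "matrix_unit i i \<in> END" "matrix_unit j j \<in> END"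
    using matrix_unit_END refl ij by auto
  have "matrix_unit i i \<circ> matrix_unit i j \<circ> matrix_unit j j = matrix_unit i j"
    using diagonal_units_sandwich[OF lin_matrix_unit] entry_matrix_unit[OF ij(1) ij(2) ij(1) ij(2)] by simp
  moreover have "\<Phi> (matrix_unit i i \<circ> matrix_unit i j \<circ> matrix_unit j j) = idem i \<circ> ?f \<circ> idem j"
    by (simp add: idem_def auto_comp END_comp E)
  ultimately have fe: "idem i (?f (idem j x)) = ?f x" for x by (metis comp_apply)
  have fl: "lin ?f" using auto_END[OF E(1)] END_lin by blast
  have z: "matrix_unit a a (?f (matrix_unit b b x)) = 0" for x
    using fun_cong[OF diagonal_units_sandwich[OF fl, of a b], of x] zero by simp
  obtain c where c: "c \<noteq> 0" "\<And>x. idem i (matrix_unit a a (idem i x)) = c *s idem i x"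
    using linked_sandwich[OF ij(1) ab(1) \<open>linked a i\<close>] by blast
  obtain d where d: "d \<noteq> 0" "\<And>x. idem j (matrix_unit b b (idem j x)) = d *s idem j x"
    using linked_sandwich[OF ij(2) ab(2) \<open>linked b j\<close>] by blast
  have "?f x = 0" for x
  proof -
    have "(c * d) *s ?f x = c *s idem i (?f (d *s idem j x))"
      using fe lin_scale[OF fl] lin_scale[OF idem_lin[OF ij(1)]] by (simp add: scale_scale)
    also have "\<dots> = idem i (matrix_unit a a (idem i (?f (idem j (matrix_unit b b (idem j x))))))"
      using c d by simp
    also have "\<dots> = idem i (matrix_unit a a (?f (matrix_unit b b (idem j x))))" using fe by simp
    also have "\<dots> = 0" using z lin_zero[OF idem_lin[OF ij(1)]] by simp
    finally show ?thesis using c d by simp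
  qed
  then show False using auto_nonzero[OF E(1) matrix_unit_nonzero[OF ij(1) ij(2)]] by auto
qed

lemma idem_rank_one: assumes i: "i < n" and c: "c < n" and "linked c i"
  shows "idem i x \<in> span {idem i (v c)}"
proof -
  obtain t where t: "t \<noteq> 0" "\<And>x. idem i (matrix_unit c c (idem i x)) = t *s idem i x"
    using linked_sandwich[OF i c \<open>linked c i\<close>] by blast
  have "t *s idem i x = coord c (idem i x) *s idem i (v c)"
    using t(2)[of x] lin_scale[OF idem_lin[OF i]] by (simp add: matrix_unit_def)
  then have "idem i x = (inverse t * coord c (idem i x)) *s idem i (v c)"
    using t(1) by (metis (no_types, lifting) left_inverse scale_one scale_scale)
  then show ?thesis by (metis span_base span_scale singletonI)
qed

context
  fixes h h' :: "nat \<Rightarrow> 'g::group_add"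
  assumes graded: "\<And>\<sigma>. \<Phi> ` ENDdeg \<rho> n (*s) v h \<sigma> = ENDdeg \<rho> n (*s) v h' \<sigma>"
begin

lemma idem_ENDdeg: "i < n \<Longrightarrow> idem i \<in> ENDdeg \<rho> n (*s) v h' 0"
  unfolding idem_def using graded[of 0] matrix_unit_ENDdeg[of i i h] refl by force

lemma linked_rel_degree:
  assumes ij: "i < n" "j < n" "\<rho> i j" and ab: "a < n" "b < n" and "linked a i" "linked b j"
  shows "\<rho> a b \<and> h' a = (h i - h j) + h' b"
proof -
  have "\<Phi> (matrix_unit i j) \<in> ENDdeg \<rho> n (*s) v h' (h i - h j)"
    using graded[of "h i - h j"] matrix_unit_ENDdeg[OF ij, of h] by force
  then show ?thesis
    using entry_auto_matrix_unit_nonzero[OF assms] ab by (auto simp: mem_ENDdeg_iff mem_END_iff)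
qed

definition linked_rep :: "nat \<Rightarrow> nat" where
  "linked_rep i = (SOME a. a < n \<and> linked a i)"

lemma linked_rep: "i < n \<Longrightarrow> linked_rep i < n \<and> linked (linked_rep i) i"
  unfolding linked_rep_def using someI_ex[OF ex_linked] by blast

definition block_key :: "nat \<Rightarrow> nat set \<times> 'g" where
  "block_key a = (cls \<rho> n a, h' a)"

definition block :: "nat set \<times> 'g \<Rightarrow> nat set" where
  "block K = {a \<in> {0..<n}. block_key a = K}"

definition idem_block :: "nat set \<times> 'g \<Rightarrow> nat set" where
  "idem_block K = {i \<in> {0..<n}. block_key (linked_rep i) = K}"

lemma entry_idem_outside_block:
  assumes i: "i < n" and a: "a \<in> block K" and b: "b \<in> block K" and other: "block_key (linked_rep i) \<noteq> K"
  shows "entry (idem i) a b = 0"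
proof (rule ccontr)
  assume nz: "entry (idem i) a b \<noteq> 0"
  let ?c = "linked_rep i"
  have c: "?c < n" "linked ?c i" using linked_rep[OF i] by auto
  have an: "a < n" and bn: "b < n" using a b by (auto simp: block_def)
  obtain t where t: "t \<noteq> 0" "\<And>x. idem i (matrix_unit ?c ?c (idem i x)) = t *s idem i x"
    using linked_sandwich[OF i c(1) c(2)] by blast
  have tv: "t *s idem i (v b) = entry (idem i) ?c b *s idem i (v ?c)"
    using t(2)[of "v b"] lin_scale[OF idem_lin[OF i]] by (simp add: matrix_unit_def entry_def)
  have "t * entry (idem i) a b = entry (idem i) ?c b * entry (idem i) a ?c"
    using arg_cong[OF tv, of "coord a"] by (simp add: coord_scale entry_def)
  then have nz2: "entry (idem i) ?c b \<noteq> 0" "entry (idem i) a ?c \<noteq> 0" using t nz by auto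
  then have r1: "\<rho> a ?c" "h' a = h' ?c" and r2: "\<rho> ?c b"
    using idem_ENDdeg[OF i] an bn c by (auto simp: mem_ENDdeg_iff mem_END_iff)
  have "cls \<rho> n a = cls \<rho> n b" "h' a = h' b" using a b by (auto simp: block_def block_key_def)
  then have "\<rho> b a" using cls_eq_iff an bn by blast
  then have "\<rho> ?c a" using rel_trans[OF c(1) bn an r2] by blast
  then have "cls \<rho> n ?c = cls \<rho> n a" using cls_eq_iff an c r1 by blast
  then have "block_key ?c = block_key a" using r1 by (simp add: block_key_def)
  then show False using a other by (simp add: block_def)
qed

definition block_proj :: "nat set \<times> 'g \<Rightarrow> 'v \<Rightarrow> 'v" where
  "block_proj K u = (\<Sum>a\<in>block K. coord a u *s v a)"

lemma finite_block: "finite (block K)"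
  by (auto simp: block_def)

lemma finite_idem_block: "finite (idem_block K)"
  by (auto simp: idem_block_def)

lemma lin_block_proj: "lin (block_proj K)"
  unfolding lin_iff block_proj_def
  by (simp add: coord_add coord_scale scale_left_distrib sum.distrib scale_sum_right)

lemma block_proj_basis: assumes a: "a \<in> block K" shows "block_proj K (v a) = v a"
proof -
  have "block_proj K (v a) = (\<Sum>a'\<in>block K. (if a' = a then v a' else 0))"
    unfolding block_proj_def
  proof (rule sum.cong[OF HOL.refl])
    fix a' assume "a' \<in> block K"
    then show "coord a' (v a) *s v a' = (if a' = a then v a' else 0)"
      using a by (simp add: block_def coord_basis)
  qed
  also have "\<dots> = v a" using a finite_block by (simp add: sum.delta')
  finally show ?thesis .
qed

lemma block_proj_idem_in_span:
  assumes i: "i < n" and a: "a \<in> block K"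
  shows "block_proj K (idem i (v a)) \<in> span ((\<lambda>j. block_proj K (idem j (v (linked_rep j)))) ` idem_block K)"
    (is "_ \<in> span ?Y")
proof (cases "block_key (linked_rep i) = K")
  case True
  then have "i \<in> idem_block K" using i by (simp add: idem_block_def)
  then have Y: "block_proj K (idem i (v (linked_rep i))) \<in> ?Y" by simp
  obtain s where "idem i (v a) = s *s idem i (v (linked_rep i))"
    using idem_rank_one[OF i] linked_rep[OF i] by (auto simp: span_singleton)
  then have "block_proj K (idem i (v a)) = s *s block_proj K (idem i (v (linked_rep i)))"
    using lin_scale[OF lin_block_proj] by simp
  then show ?thesis using Y by (simp add: span_base span_scale)
next
  case False
  have "block_proj K (idem i (v a)) = (\<Sum>a'\<in>block K. entry (idem i) a' a *s v a')"
    by (simp add: block_proj_def entry_def)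
  also have "\<dots> = 0" using entry_idem_outside_block[OF i _ a False] by simp
  finally show ?thesis by (simp add: span_zero)
qed

lemma card_block_le: "card (block K) \<le> card (idem_block K)"
proof -
  define Y where "Y = (\<lambda>j. block_proj K (idem j (v (linked_rep j)))) ` idem_block K"
  have "v a \<in> span Y" if a: "a \<in> block K" for a
  proof -
    have "v a = block_proj K (\<Sum>i<n. idem i (v a))" using block_proj_basis[OF a] sum_idem by simp
    also have "\<dots> = (\<Sum>i<n. block_proj K (idem i (v a)))" by (rule lin_sum[OF lin_block_proj])
    also have "\<dots> \<in> span Y"
      unfolding Y_def by (rule span_sum) (use block_proj_idem_in_span a in simp)
    finally show ?thesis .
  qed
  moreover have "independent (v ` block K)"
    by (rule independent_mono[OF indep]) (auto simp: block_def)
  ultimately have "card (v ` block K) \<le> card Y"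
    using independent_span_bound[of Y "v ` block K"] finite_idem_block by (auto simp: Y_def)
  also have "\<dots> \<le> card (idem_block K)" unfolding Y_def by (rule card_image_le[OF finite_idem_block])
  finally have "card (v ` block K) \<le> card (idem_block K)" .
  moreover have "card (v ` block K) = card (block K)"
    by (rule card_image[OF inj_on_subset[OF inj]]) (auto simp: block_def)
  ultimately show ?thesis by simp
qed

lemma card_block_eq: "card (block K) = card (idem_block K)"
proof (cases "K \<in> block_key ` {0..<n}")
  case True
  have total: "(\<Sum>K\<in>block_key ` {0..<n}. card {x \<in> {0..<n}. f x = K}) = n"
    if "\<And>x. x < n \<Longrightarrow> f x \<in> block_key ` {0..<n}" for f :: "nat \<Rightarrow> nat set \<times> 'g"
  proof -
    have "(\<Sum>x\<in>{0..<n}. (\<lambda>_. 1::nat) (f x)) =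
        (\<Sum>K\<in>block_key ` {0..<n}. of_nat (card {x \<in> {0..<n}. f x = K}) * (\<lambda>_. 1) K)"
      by (rule sum_fun_comp) (use that in auto)
    then show ?thesis by simp
  qed
  have "(\<Sum>K\<in>block_key ` {0..<n}. card (block K)) = n"
    unfolding block_def by (rule total) auto
  moreover have "(\<Sum>K\<in>block_key ` {0..<n}. card (idem_block K)) = n"
    unfolding idem_block_def by (rule total) (use linked_rep in auto)
  ultimately show ?thesis
    by (intro sum_mono_inv[of "\<lambda>K. card (block K)" _ "\<lambda>K. card (idem_block K)"])
      (use card_block_le True in auto)
next
  case False
  then have "block K = {}" "idem_block K = {}"
    using linked_rep by (auto simp: block_def idem_block_def)
  then show ?thesis by simp
qed

lemma rel_degree_of_linked_keys:
  assumes ij: "i < n" "j < n" "\<rho> i j"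
    and p: "p < n" "block_key p = block_key (linked_rep i)"
    and q: "q < n" "block_key q = block_key (linked_rep j)"
  shows "\<rho> p q \<and> h' p = (h i - h j) + h' q"
proof -
  have ri: "linked_rep i < n" "linked (linked_rep i) i" and rj: "linked_rep j < n" "linked (linked_rep j) j"
    using linked_rep ij by auto
  have rel: "\<rho> (linked_rep i) (linked_rep j) \<and> h' (linked_rep i) = (h i - h j) + h' (linked_rep j)"
    by (rule linked_rel_degree[OF ij ri(1) rj(1) ri(2) rj(2)])
  have cp: "cls \<rho> n p = cls \<rho> n (linked_rep i)" "h' p = h' (linked_rep i)"
    and cq: "cls \<rho> n q = cls \<rho> n (linked_rep j)" "h' q = h' (linked_rep j)"
    using p(2) q(2) by (auto simp: block_key_def)
  have "\<rho> p (linked_rep i)" using cls_eq_iff[OF p(1) ri(1)] cp by simp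
  moreover have "\<rho> (linked_rep j) q" using cls_eq_iff[OF q(1) rj(1)] cq by simp
  ultimately have "\<rho> p q"
    using rel rel_trans[OF p(1) ri(1) rj(1)] rel_trans[OF p(1) rj(1) q(1)] by blast
  then show ?thesis using rel cp cq by simp
qed

lemma ex_monotone_bij: "\<exists>\<pi>. bij_betw \<pi> {0..<n} {0..<n} \<and> (\<forall>i<n. \<forall>j<n. \<rho> i j \<longrightarrow> \<rho> (\<pi> i) (\<pi> j))
    \<and> elementary_degrees_agree \<rho> n h (h' \<circ> \<pi>)"
proof -
  obtain \<pi> where bij: "bij_betw \<pi> {0..<n} {0..<n}"
    and key: "\<forall>i\<in>{0..<n}. block_key (\<pi> i) = block_key (linked_rep i)"
    using ex_bij_betw_fibres_eq[of "{0..<n}" block_key "\<lambda>i. block_key (linked_rep i)"] card_block_eq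
    by (auto simp: block_def idem_block_def)
  have \<pi>_less: "i < n \<Longrightarrow> \<pi> i < n" for i using bij by (auto simp: bij_betw_def)
  have main: "\<rho> (\<pi> i) (\<pi> j) \<and> h' (\<pi> i) = (h i - h j) + h' (\<pi> j)" if "i < n" "j < n" "\<rho> i j" for i j
    using rel_degree_of_linked_keys[OF that \<pi>_less[OF that(1)] _ \<pi>_less[OF that(2)]] key that by simp
  have "elementary_degrees_agree \<rho> n h (h' \<circ> \<pi>)"
    unfolding elementary_degrees_agree_def using main by (simp add: eq_diff_eq)
  then show ?thesis using bij main by blast
qed

end

end

end

section \<open>Relabellings of the basis yield graded isomorphisms\<close>

context finite_basis
begin

definition reindex_coords :: "(nat \<Rightarrow> nat) \<Rightarrow> 'v \<Rightarrow> 'v" where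
  "reindex_coords k u = (\<Sum>b<n. coord (k b) u *s v b)"

definition map_basis :: "(nat \<Rightarrow> nat) \<Rightarrow> 'v \<Rightarrow> 'v" where
  "map_basis k u = (\<Sum>b<n. coord b u *s v (k b))"

lemma lin_reindex_coords: "lin (reindex_coords k)"
  unfolding lin_iff reindex_coords_def
  by (simp add: coord_add coord_scale scale_left_distrib sum.distrib scale_sum_right)

lemma lin_map_basis: "lin (map_basis k)"
  unfolding lin_iff map_basis_def
  by (simp add: coord_add coord_scale scale_left_distrib sum.distrib scale_sum_right)

definition basis_conj :: "(nat \<Rightarrow> nat) \<Rightarrow> ('v \<Rightarrow> 'v) \<Rightarrow> 'v \<Rightarrow> 'v" where
  "basis_conj k f = reindex_coords k \<circ> f \<circ> map_basis k"

definition basis_conj_inv :: "(nat \<Rightarrow> nat) \<Rightarrow> ('v \<Rightarrow> 'v) \<Rightarrow> 'v \<Rightarrow> 'v" where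
  "basis_conj_inv k f = map_basis k \<circ> f \<circ> reindex_coords k"

context
  fixes k assumes k: "bij_betw k {0..<n} {0..<n}"
begin

lemma perm_less: "a < n \<Longrightarrow> k a < n"
  using k by (auto simp: bij_betw_def)

lemma perm_eq_iff: "a < n \<Longrightarrow> b < n \<Longrightarrow> k a = k b \<longleftrightarrow> a = b"
  using k by (auto simp: bij_betw_def inj_on_def)

lemma perm_surj: "c < n \<Longrightarrow> \<exists>a<n. c = k a"
  using k by (force simp: bij_betw_def)

lemma coord_reindex_coords: "a < n \<Longrightarrow> coord a (reindex_coords k u) = coord (k a) u"
  by (simp add: reindex_coords_def coord_sum coord_scale coord_basis if_distrib[of "(*) _"] cong: if_cong)

lemma coord_map_basis: "a < n \<Longrightarrow> coord (k a) (map_basis k u) = coord a u"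
  by (simp add: map_basis_def coord_sum coord_scale coord_basis perm_less perm_eq_iff
      if_distrib[of "(*) _"] cong: if_cong)

lemma coord_eq_perm_coords: "(\<And>a. a < n \<Longrightarrow> coord (k a) x = coord (k a) y) \<Longrightarrow> x = y"
  by (rule coord_eqI) (metis perm_surj)

lemma reindex_map_basis: "reindex_coords k (map_basis k u) = u"
  by (rule coord_eqI) (simp add: coord_reindex_coords coord_map_basis)

lemma map_reindex_coords: "map_basis k (reindex_coords k u) = u"
  by (rule coord_eq_perm_coords) (simp add: coord_reindex_coords coord_map_basis perm_less)

lemma map_basis_basis: "b < n \<Longrightarrow> map_basis k (v b) = v (k b)"
  by (rule coord_eq_perm_coords) (simp add: coord_map_basis coord_basis perm_less perm_eq_iff)

lemma reindex_coords_basis: "b < n \<Longrightarrow> reindex_coords k (v (k b)) = v b"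
  by (rule coord_eqI) (simp add: coord_reindex_coords coord_basis perm_less perm_eq_iff)

lemma entry_basis_conj: "a < n \<Longrightarrow> b < n \<Longrightarrow> entry (basis_conj k f) a b = entry f (k a) (k b)"
  by (simp add: basis_conj_def entry_def coord_reindex_coords map_basis_basis)

lemma entry_basis_conj_inv: "a < n \<Longrightarrow> b < n \<Longrightarrow> entry (basis_conj_inv k f) (k a) (k b) = entry f a b"
  by (simp add: basis_conj_inv_def entry_def coord_map_basis reindex_coords_basis)

lemma basis_conj_inv_cancel: "basis_conj k (basis_conj_inv k f) = f"
  by (rule ext) (simp add: basis_conj_def basis_conj_inv_def reindex_map_basis)

lemma basis_conj_cancel: "basis_conj_inv k (basis_conj k f) = f"
  by (rule ext) (simp add: basis_conj_def basis_conj_inv_def map_reindex_coords)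

end

end

context flag_basis
begin

context
  fixes k assumes k: "preorder_auto \<rho> n k"
begin

lemma preorder_auto_bij: "bij_betw k {0..<n} {0..<n}"
  using k by (simp add: preorder_auto_def)

lemma preorder_auto_rel_iff: "a < n \<Longrightarrow> b < n \<Longrightarrow> \<rho> (k a) (k b) \<longleftrightarrow> \<rho> a b"
  using k by (simp add: preorder_auto_def)

lemma preorder_auto_less: "a < n \<Longrightarrow> k a < n"
  by (rule perm_less[OF preorder_auto_bij])

lemma preorder_auto_surj: "c < n \<Longrightarrow> \<exists>a<n. c = k a"
  by (rule perm_surj[OF preorder_auto_bij])

lemma basis_conj_END: "f \<in> END \<Longrightarrow> basis_conj k f \<in> END"
  unfolding mem_END_iff
proof (intro conjI allI impI)
  assume f: "lin f \<and> (\<forall>a<n. \<forall>b<n. entry f a b \<noteq> 0 \<longrightarrow> \<rho> a b)"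
  show "lin (basis_conj k f)"
    unfolding basis_conj_def using f lin_reindex_coords lin_map_basis by (auto intro!: lin_comp)
  fix a b assume ab: "a < n" "b < n" and "entry (basis_conj k f) a b \<noteq> 0"
  then have "entry f (k a) (k b) \<noteq> 0" using entry_basis_conj[OF preorder_auto_bij] by simp
  then have "\<rho> (k a) (k b)" using f preorder_auto_less ab by blast
  then show "\<rho> a b" using preorder_auto_rel_iff ab by simp
qed

lemma basis_conj_inv_END: "f \<in> END \<Longrightarrow> basis_conj_inv k f \<in> END"
  unfolding mem_END_iff
proof (intro conjI allI impI)
  assume f: "lin f \<and> (\<forall>a<n. \<forall>b<n. entry f a b \<noteq> 0 \<longrightarrow> \<rho> a b)"
  show "lin (basis_conj_inv k f)"
    unfolding basis_conj_inv_def using f lin_reindex_coords lin_map_basis by (auto intro!: lin_comp)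
  fix c d assume c: "c < n" and d: "d < n" and nz: "entry (basis_conj_inv k f) c d \<noteq> 0"
  obtain a b where ab: "a < n" "b < n" "c = k a" "d = k b" using preorder_auto_surj c d by metis
  then have "entry f a b \<noteq> 0" using nz entry_basis_conj_inv[OF preorder_auto_bij] by simp
  then show "\<rho> c d" using f ab preorder_auto_rel_iff by simp
qed

lemma END_automorphism_basis_conj: "END_automorphism (basis_conj k)"
  unfolding END_automorphism_def
proof (intro conjI ballI allI)
  show "bij_betw (basis_conj k) END END"
    by (rule bij_betw_byWitness[where f'="basis_conj_inv k"])
      (auto simp: basis_conj_cancel[OF preorder_auto_bij] basis_conj_inv_cancel[OF preorder_auto_bij]
        basis_conj_END basis_conj_inv_END)
  fix f g assume "f \<in> END" "g \<in> END"
  show "basis_conj k (\<lambda>x. f x + g x) = (\<lambda>x. basis_conj k f x + basis_conj k g x)"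
    by (rule ext) (simp add: basis_conj_def lin_add[OF lin_reindex_coords])
  show "basis_conj k (f \<circ> g) = basis_conj k f \<circ> basis_conj k g"
    by (rule ext) (simp add: basis_conj_def map_reindex_coords[OF preorder_auto_bij])
next
  fix c f
  show "basis_conj k (\<lambda>x. c *s f x) = (\<lambda>x. c *s basis_conj k f x)"
    by (rule ext) (simp add: basis_conj_def lin_scale[OF lin_reindex_coords])
next
  show "basis_conj k id = id"
    by (rule ext) (simp add: basis_conj_def reindex_map_basis[OF preorder_auto_bij])
qed

lemma basis_conj_ENDdeg:
  assumes deg: "elementary_degrees_agree \<rho> n (h \<circ> k) h'"
  shows "basis_conj k ` ENDdeg \<rho> n (*s) v h \<sigma> = ENDdeg \<rho> n (*s) v h' \<sigma>"
proof -
  have deg': "h (k a) = \<sigma> + h (k b) \<longleftrightarrow> h' a = \<sigma> + h' b" if "a < n" "b < n" "\<rho> a b" for a b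
    using deg that unfolding elementary_degrees_agree_def by (metis comp_apply diff_eq_eq)
  have forward: "basis_conj k f \<in> ENDdeg \<rho> n (*s) v h' \<sigma>" if f: "f \<in> ENDdeg \<rho> n (*s) v h \<sigma>" for f
    unfolding mem_ENDdeg_iff
  proof (intro conjI allI impI)
    show "basis_conj k f \<in> END" using f basis_conj_END by (simp add: mem_ENDdeg_iff)
    fix a b assume ab: "a < n" "b < n" "entry (basis_conj k f) a b \<noteq> 0"
    then have "entry f (k a) (k b) \<noteq> 0" using entry_basis_conj[OF preorder_auto_bij] by simp
    then have "\<rho> (k a) (k b)" "h (k a) = \<sigma> + h (k b)"
      using f preorder_auto_less ab by (auto simp: mem_ENDdeg_iff mem_END_iff)
    then show "h' a = \<sigma> + h' b" using ab deg' preorder_auto_rel_iff by blast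
  qed
  have backward: "basis_conj_inv k f \<in> ENDdeg \<rho> n (*s) v h \<sigma>" if f: "f \<in> ENDdeg \<rho> n (*s) v h' \<sigma>" for f
    unfolding mem_ENDdeg_iff
  proof (intro conjI allI impI)
    show "basis_conj_inv k f \<in> END" using f basis_conj_inv_END by (simp add: mem_ENDdeg_iff)
    fix c d assume c: "c < n" and d: "d < n" and nz: "entry (basis_conj_inv k f) c d \<noteq> 0"
    obtain a b where ab: "a < n" "b < n" "c = k a" "d = k b" using preorder_auto_surj c d by metis
    then have "entry f a b \<noteq> 0" using nz entry_basis_conj_inv[OF preorder_auto_bij] by simp
    then have "\<rho> a b" "h' a = \<sigma> + h' b" using f ab by (auto simp: mem_ENDdeg_iff mem_END_iff)
    then show "h c = \<sigma> + h d" using ab deg' by blast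
  qed
  show ?thesis
  proof (intro equalityI subsetI)
    fix y assume "y \<in> basis_conj k ` ENDdeg \<rho> n (*s) v h \<sigma>"
    then show "y \<in> ENDdeg \<rho> n (*s) v h' \<sigma>" using forward by blast
  next
    fix y assume "y \<in> ENDdeg \<rho> n (*s) v h' \<sigma>"
    then show "y \<in> basis_conj k ` ENDdeg \<rho> n (*s) v h \<sigma>"
      using backward basis_conj_inv_cancel[OF preorder_auto_bij] by (metis image_eqI)
  qed
qed

end

lemma graded_END_iso_iff_preorder_auto:
  "graded_END_iso \<rho> n (*s) v h h' \<longleftrightarrow> (\<exists>k. preorder_auto \<rho> n k \<and> elementary_degrees_agree \<rho> n (h \<circ> k) h')"
proof
  assume "graded_END_iso \<rho> n (*s) v h h'"
  then obtain \<Phi> where "END_automorphism \<Phi>" "\<And>\<sigma>. \<Phi> ` ENDdeg \<rho> n (*s) v h \<sigma> = ENDdeg \<rho> n (*s) v h' \<sigma>"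
    by (auto simp: graded_END_iso_iff)
  then obtain \<pi> where "bij_betw \<pi> {0..<n} {0..<n}" "\<forall>i<n. \<forall>j<n. \<rho> i j \<longrightarrow> \<rho> (\<pi> i) (\<pi> j)"
      "elementary_degrees_agree \<rho> n h (h' \<circ> \<pi>)"
    using ex_monotone_bij by blast
  then show "\<exists>k. preorder_auto \<rho> n k \<and> elementary_degrees_agree \<rho> n (h \<circ> k) h'"
    by (rule ex_preorder_auto_if_monotone_bij)
next
  assume "\<exists>k. preorder_auto \<rho> n k \<and> elementary_degrees_agree \<rho> n (h \<circ> k) h'"
  then obtain k where "preorder_auto \<rho> n k" "elementary_degrees_agree \<rho> n (h \<circ> k) h'" by blast
  then show "graded_END_iso \<rho> n (*s) v h h'"
    unfolding graded_END_iso_iff using END_automorphism_basis_conj basis_conj_ENDdeg by blast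
qed

end

theorem theorem7p1:
  fixes \<rho> :: "nat \<Rightarrow> nat \<Rightarrow> bool" and n :: nat
    and scale :: "'k::field \<Rightarrow> 'v::ab_group_add \<Rightarrow> 'v" and v :: "nat \<Rightarrow> 'v"
    and h h' :: "nat \<Rightarrow> 'g::group_add"
  assumes refl: "\<forall>i<n. \<rho> i i"
    and trans: "\<forall>i<n. \<forall>j<n. \<forall>k<n. \<rho> i j \<and> \<rho> j k \<longrightarrow> \<rho> i k"
    and vs: "vector_space scale"
    and inj: "inj_on v {0..<n}"
    and indep: "\<not> Modules.module.dependent scale (v ` {0..<n})"
    and spans: "Modules.module.span scale (v ` {0..<n}) = UNIV"
  shows "graded_END_iso \<rho> n scale v h h' \<longleftrightarrow>
    (\<exists>\<psi> g \<sigma>. (\<forall>\<alpha>\<in>classes \<rho> n. \<psi> \<alpha> permutes \<alpha>) \<and> g \<in> Aut0 \<rho> n \<and>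
       (\<forall>i<n. h' i = h (\<psi> (g (cls \<rho> n i)) (gtilde \<rho> n g i)) + \<sigma> (component \<rho> n (cls \<rho> n i))))"
proof -
  interpret flag_basis scale n v \<rho>
    using vs inj indep spans refl trans
    by (intro flag_basis.intro finite_basis.intro finite_basis_axioms.intro index_preorder.intro)
  show ?thesis by (simp only: graded_END_iso_iff_preorder_auto orbit_iff_preorder_auto)
qed

end
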